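(* Let $M$ be a partial commutative monoid that is moreover an effect algebra, with induced difference $n-m$ (the unique $k$ with $m+k=n$, defined when $m\preceq n$), and let $(\{\mathbb{E}_m\},\nabla,\eta)$ be an $M$-graded effect monoid. Then $\{D_{\mathbb{E}_m}\}$, with unit $\eta(x)=1_{\mathbb{E}_0}\bullet x$ and multiplication $\mu_{m,n}(\sum_i e_i\bullet\Delta_i)(x)=\sum_i\nabla_{m,n}(e_i,\Delta_i(x))$, is an extensible $M$-graded monad with extension $\xi_{m\preceq n}:D_{\mathbb{E}_m}\to D_{\mathbb{E}_n}$ given by $\xi_{m\preceq n}(\sum_i e_i\bullet x_i)=\sum_i\nabla_{m,n-m}(e_i,1_{\mathbb{E}_{n-m}})\bullet x_i$.
   Context: A partial commutative monoid (PCM) $\langle M,0,+\rangle$ has a partial, commutative, associative operation $+$ with unit $0$ ($a\perp b$ means $a+b$ is defined); its preorder is $a\preceq b$ iff $a+c=b$ for some $c$. An effect algebra is a PCM with $e\mapsto e'$ such that $e'$ is the unique element with $e+e'=1:=0'$ and $e\perp1\Rightarrow e=0$. Effect morphisms preserve $0$, defined sums and $'$; morphisms $\mathbb{E}_A\otimes\mathbb{E}_B\to\mathbb{E}_C$ in the monoidal category $\mathbf{EA}$ (unit $2=\{0,1\}$) correspond to bimorphisms $\mathbb{E}_A\times\mathbb{E}_B\to\mathbb{E}_C$ (PCM homomorphisms in each argument sending $(1,1)$ to $1$). An $M$-graded effect monoid: effect algebras $\mathbb{E}_m$, bimorphisms $\nabla_{m,n}:\mathbb{E}_m\times\mathbb{E}_n\to\mathbb{E}_{m+n}$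 for $m\perp n$, an effect morphism $\eta:2\to\mathbb{E}_0$, with $\nabla_{m+n,o}(\nabla_{m,n}(a,b),c)=\nabla_{m,n+o}(a,\nabla_{n,o}(b,c))$ and $\nabla_{0,m}(\eta(1),a)=a=\nabla_{m,0}(a,\eta(1))$. $D_{\mathbb{E}}X$: finitely supported $\Delta:X\to\mathbb{E}$ whose sum over the support is defined; $(D_{\mathbb{E}}f)(\Delta)(y)=\sum_{x\in f^{-1}(y)}\Delta(x)$; $\sum_ie_i\bullet x_i$ assigns $e_i$ to $x_i$. An $M$-graded monad on $\mathbf{Set}$: endofunctors $T_m$, natural $\eta:\mathrm{Id}\to T_0$, natural $\mu_{m,n}:T_mT_n\to T_{m+n}$ for $m\perp n$, with $\mu_{m,n+o}\circ T_m\mu_{n,o}=\mu_{m+n,o}\circ\mu_{m,n}T_o$ and $\mu_{m,0}\circ T_m\eta=\mathrm{id}=\mu_{0,m}\circ\eta T_m$. It is extensible if for all $m\preceq n$ there is a natural transformation $\xi_{m\preceq n}:T_m\to T_n$ with $\xi_{m\preceq m}=\mathrm{Id}$ and $\xi_{n\preceq o}\circ\xi_{m\preceq n}=\xi_{m\preceq o}$. *)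

theory Defs
  imports "HOL-Library.FuncSet"
begin

record 'a pcm_struct =
  carrier :: "'a set"
  zero :: 'a
  padd :: "'a \<Rightarrow> 'a \<Rightarrow> 'a option"

text \<open>
  The partial operation \<open>carrier M \<times> carrier M \<rightharpoonup> carrier M\<close> is an \<open>option\<close>-valued function
  that is \<open>None\<close> whenever an argument lies outside the carrier.
  The equations between \<open>option\<close> values are Kleene equalities: one side is defined iff
  the other one is.
\<close>

locale pcm =
  fixes M :: "('a, 'z) pcm_struct_scheme"
  assumes padd_dom: "padd M a b = Some c \<Longrightarrow> a \<in> carrier M \<and> b \<in> carrier M \<and> c \<in> carrier M"
    and zero_closed: "zero M \<in> carrier M"
    and padd_zero: "a \<in> carrier M \<Longrightarrow> padd M a (zero M) = Some a"
    and padd_commute: "padd M a b = padd M b a"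
    and padd_assoc:
      "Option.bind (padd M a b) (\<lambda>d. padd M d c) = Option.bind (padd M b c) (\<lambda>d. padd M a d)"

definition ple :: "('a, 'z) pcm_struct_scheme \<Rightarrow> 'a \<Rightarrow> 'a \<Rightarrow> bool" where
  "ple M a b \<longleftrightarrow> (\<exists>c. padd M a c = Some b)"

definition pdiff :: "('a, 'z) pcm_struct_scheme \<Rightarrow> 'a \<Rightarrow> 'a \<Rightarrow> 'a" where
  "pdiff M n m = (THE k. padd M m k = Some n)"

text \<open>The partial sum of \<open>f x\<close> over \<open>x \<in> S\<close>, only meaningful for finite \<open>S\<close>.\<close>

definition psum :: "('a, 'z) pcm_struct_scheme \<Rightarrow> ('x \<Rightarrow> 'a) \<Rightarrow> 'x set \<Rightarrow> 'a option" where
  "psum M f S = Finite_Set.fold (\<lambda>x acc. Option.bind acc (padd M (f x))) (Some (zero M)) S"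

record 'a effect_struct = "'a pcm_struct" +
  orth :: "'a \<Rightarrow> 'a"

definition one :: "('a, 'z) effect_struct_scheme \<Rightarrow> 'a" where
  "one A = orth A (zero A)"

locale effect_algebra = pcm A for A :: "('a, 'z) effect_struct_scheme" +
  assumes orth_closed: "e \<in> carrier A \<Longrightarrow> orth A e \<in> carrier A"
    and orth_sum: "e \<in> carrier A \<Longrightarrow> padd A e (orth A e) = Some (one A)"
    and orth_unique: "padd A e d = Some (one A) \<Longrightarrow> d = orth A e"
    and zero_one_law: "padd A e (one A) \<noteq> None \<Longrightarrow> e = zero A"

definition pcm_hom ::
  "('a, 'y) pcm_struct_scheme \<Rightarrow> ('b, 'z) pcm_struct_scheme \<Rightarrow> ('a \<Rightarrow> 'b) \<Rightarrow> bool" where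
  "pcm_hom A B f \<longleftrightarrow>
     f \<in> carrier A \<rightarrow> carrier B \<and>
     f (zero A) = zero B \<and>
     (\<forall>a b c. padd A a b = Some c \<longrightarrow> padd B (f a) (f b) = Some (f c))"

definition effect_morphism ::
  "('a, 'y) effect_struct_scheme \<Rightarrow> ('b, 'z) effect_struct_scheme \<Rightarrow> ('a \<Rightarrow> 'b) \<Rightarrow> bool" where
  "effect_morphism A B f \<longleftrightarrow>
     pcm_hom A B f \<and> (\<forall>e\<in>carrier A. f (orth A e) = orth B (f e))"

definition bimorphism ::
  "('a, 'x) effect_struct_scheme \<Rightarrow> ('b, 'y) effect_struct_scheme \<Rightarrow>
   ('c, 'z) effect_struct_scheme \<Rightarrow> ('a \<Rightarrow> 'b \<Rightarrow> 'c) \<Rightarrow> bool" where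
  "bimorphism A B C f \<longleftrightarrow>
     (\<forall>b\<in>carrier B. pcm_hom A C (\<lambda>a. f a b)) \<and>
     (\<forall>a\<in>carrier A. pcm_hom B C (\<lambda>b. f a b)) \<and>
     f (one A) (one B) = one C"

definition two :: "bool effect_struct" where
  "two = \<lparr>carrier = UNIV, zero = False,
          padd = (\<lambda>a b. if a \<and> b then None else Some (a \<or> b)), orth = Not\<rparr>"

text \<open>
  The effect algebras \<open>E m\<close> have independent carriers inside one type, which may be taken
  to contain the disjoint union of any given family.
\<close>

locale graded_effect_monoid = pcm M
  for M :: "('m, 'z) pcm_struct_scheme" +
  fixes E :: "'m \<Rightarrow> 'e effect_struct"
    and nabla :: "'m \<Rightarrow> 'm \<Rightarrow> 'e \<Rightarrow> 'e \<Rightarrow> 'e"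
    and eta :: "bool \<Rightarrow> 'e"
  assumes effect_algebra_E: "m \<in> carrier M \<Longrightarrow> effect_algebra (E m)"
    and nabla_bimorphism: "padd M m n = Some k \<Longrightarrow> bimorphism (E m) (E n) (E k) (nabla m n)"
    and eta_morphism: "effect_morphism two (E (zero M)) eta"
    and nabla_assoc:
      "\<lbrakk>padd M m n = Some mn; padd M mn p = Some k; padd M n p = Some np;
        a \<in> carrier (E m); b \<in> carrier (E n); c \<in> carrier (E p)\<rbrakk>
       \<Longrightarrow> nabla mn p (nabla m n a b) c = nabla m np a (nabla n p b c)"
    and nabla_unit_left:
      "\<lbrakk>m \<in> carrier M; a \<in> carrier (E m)\<rbrakk> \<Longrightarrow> nabla (zero M) m (eta True) a = a"
    and nabla_unit_right:
      "\<lbrakk>m \<in> carrier M; a \<in> carrier (E m)\<rbrakk> \<Longrightarrow> nabla m (zero M) a (eta True) = a"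

definition supp :: "('e, 'z) effect_struct_scheme \<Rightarrow> 'x set \<Rightarrow> ('x \<Rightarrow> 'e) \<Rightarrow> 'x set" where
  "supp A X \<Delta> = {x \<in> X. \<Delta> x \<noteq> zero A}"

definition fdist :: "('e, 'z) effect_struct_scheme \<Rightarrow> 'x set \<Rightarrow> ('x \<Rightarrow> 'e) set" where
  "fdist A X =
     {\<Delta> \<in> X \<rightarrow>\<^sub>E carrier A. finite (supp A X \<Delta>) \<and> psum A \<Delta> (supp A X \<Delta>) \<noteq> None}"

definition fdist_map ::
  "('e, 'z) effect_struct_scheme \<Rightarrow> 'x set \<Rightarrow> 'y set \<Rightarrow> ('x \<Rightarrow> 'y) \<Rightarrow> ('x \<Rightarrow> 'e) \<Rightarrow> ('y \<Rightarrow> 'e)" where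
  "fdist_map A X Y f =
     (\<lambda>\<Delta>\<in>fdist A X. \<lambda>y\<in>Y. the (psum A \<Delta> {x \<in> supp A X \<Delta>. f x = y}))"

definition fdist_unit ::
  "('m, 'z) pcm_struct_scheme \<Rightarrow> ('m \<Rightarrow> 'e effect_struct) \<Rightarrow> 'x set \<Rightarrow> 'x \<Rightarrow> ('x \<Rightarrow> 'e)" where
  "fdist_unit M E X =
     (\<lambda>x\<in>X. \<lambda>y\<in>X. if y = x then one (E (zero M)) else zero (E (zero M)))"

definition fdist_mult ::
  "('m, 'z) pcm_struct_scheme \<Rightarrow> ('m \<Rightarrow> 'e effect_struct) \<Rightarrow> ('m \<Rightarrow> 'm \<Rightarrow> 'e \<Rightarrow> 'e \<Rightarrow> 'e) \<Rightarrow>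
   'm \<Rightarrow> 'm \<Rightarrow> 'x set \<Rightarrow> (('x \<Rightarrow> 'e) \<Rightarrow> 'e) \<Rightarrow> ('x \<Rightarrow> 'e)" where
  "fdist_mult M E nabla m n X =
     (\<lambda>\<Xi>\<in>fdist (E m) (fdist (E n) X). \<lambda>x\<in>X.
        the (psum (E (the (padd M m n))) (\<lambda>\<Delta>. nabla m n (\<Xi> \<Delta>) (\<Delta> x))
                  (supp (E m) (fdist (E n) X) \<Xi>)))"

definition fdist_ext ::
  "('m, 'z) pcm_struct_scheme \<Rightarrow> ('m \<Rightarrow> 'e effect_struct) \<Rightarrow> ('m \<Rightarrow> 'm \<Rightarrow> 'e \<Rightarrow> 'e \<Rightarrow> 'e) \<Rightarrow>
   'm \<Rightarrow> 'm \<Rightarrow> 'x set \<Rightarrow> ('x \<Rightarrow> 'e) \<Rightarrow> ('x \<Rightarrow> 'e)" where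
  "fdist_ext M E nabla m n X =
     (\<lambda>\<Delta>\<in>fdist (E m) X. \<lambda>x\<in>X. nabla m (pdiff M n m) (\<Delta> x) (one (E (pdiff M n m))))"

text \<open>
  Objects of the category of sets are sets over arbitrary types, and a morphism from
  \<open>X\<close> to \<open>Y\<close> is an element of \<open>X \<rightarrow>\<^sub>E Y\<close>; composition is \<^const>\<open>compose\<close>.

  An endofunctor is a family of maps that is polymorphic in the element type.  HOL cannot
  quantify over such families, so each law takes the family as several parameters, one for
  every type instance at which the law uses it.  The suffix names the instance:
  \<open>a\<close>, \<open>b\<close>, \<open>c\<close> are the element types of arbitrary sets \<open>X\<close>, \<open>Y\<close>, \<open>Z\<close>, and \<open>ta\<close>, \<open>tta\<close>, \<open>ttta\<close>
  those of one, two and three applications of the functors to \<open>X\<close>.  A polymorphic family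
  has the stated structure if the predicate holds, at all types, with every parameter of
  the same kind instantiated by that family.
\<close>

definition set_functor ::
  "('a set \<Rightarrow> 'ta set) \<Rightarrow> ('b set \<Rightarrow> 'tb set) \<Rightarrow> ('c set \<Rightarrow> 'tc set) \<Rightarrow>
   ('a set \<Rightarrow> 'a set \<Rightarrow> ('a \<Rightarrow> 'a) \<Rightarrow> ('ta \<Rightarrow> 'ta)) \<Rightarrow>
   ('a set \<Rightarrow> 'b set \<Rightarrow> ('a \<Rightarrow> 'b) \<Rightarrow> ('ta \<Rightarrow> 'tb)) \<Rightarrow>
   ('b set \<Rightarrow> 'c set \<Rightarrow> ('b \<Rightarrow> 'c) \<Rightarrow> ('tb \<Rightarrow> 'tc)) \<Rightarrow>
   ('a set \<Rightarrow> 'c set \<Rightarrow> ('a \<Rightarrow> 'c) \<Rightarrow> ('ta \<Rightarrow> 'tc)) \<Rightarrow> bool" where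
  "set_functor Ta Tb Tc F_a_a F_a_b F_b_c F_a_c \<longleftrightarrow>
     (\<forall>X Y. \<forall>f \<in> X \<rightarrow>\<^sub>E Y. F_a_b X Y f \<in> Ta X \<rightarrow>\<^sub>E Tb Y) \<and>
     (\<forall>X. F_a_a X X (\<lambda>x\<in>X. x) = (\<lambda>t\<in>Ta X. t)) \<and>
     (\<forall>X Y Z. \<forall>f \<in> X \<rightarrow>\<^sub>E Y. \<forall>g \<in> Y \<rightarrow>\<^sub>E Z.
        F_a_c X Z (compose X g f) = compose (Ta X) (F_b_c Y Z g) (F_a_b X Y f))"

definition nat_trans ::
  "('a set \<Rightarrow> 'sa set) \<Rightarrow> ('b set \<Rightarrow> 'sb set) \<Rightarrow>
   ('a set \<Rightarrow> 'b set \<Rightarrow> ('a \<Rightarrow> 'b) \<Rightarrow> ('sa \<Rightarrow> 'sb)) \<Rightarrow>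
   ('a set \<Rightarrow> 'ta set) \<Rightarrow> ('b set \<Rightarrow> 'tb set) \<Rightarrow>
   ('a set \<Rightarrow> 'b set \<Rightarrow> ('a \<Rightarrow> 'b) \<Rightarrow> ('ta \<Rightarrow> 'tb)) \<Rightarrow>
   ('a set \<Rightarrow> 'sa \<Rightarrow> 'ta) \<Rightarrow> ('b set \<Rightarrow> 'sb \<Rightarrow> 'tb) \<Rightarrow> bool" where
  "nat_trans Sa Sb G_a_b Ta Tb F_a_b \<alpha>_a \<alpha>_b \<longleftrightarrow>
     (\<forall>X. \<alpha>_a X \<in> Sa X \<rightarrow>\<^sub>E Ta X) \<and>
     (\<forall>Y. \<alpha>_b Y \<in> Sb Y \<rightarrow>\<^sub>E Tb Y) \<and>
     (\<forall>X Y. \<forall>f \<in> X \<rightarrow>\<^sub>E Y.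
        compose (Sa X) (F_a_b X Y f) (\<alpha>_a X) = compose (Sa X) (\<alpha>_b Y) (G_a_b X Y f))"

locale graded_monad = pcm M
  for M :: "('m, 'z) pcm_struct_scheme" +
  fixes Ta :: "'m \<Rightarrow> 'a set \<Rightarrow> 'ta set"
    and Tb :: "'m \<Rightarrow> 'b set \<Rightarrow> 'tb set"
    and Tc :: "'m \<Rightarrow> 'c set \<Rightarrow> 'tc set"
    and Tta :: "'m \<Rightarrow> 'ta set \<Rightarrow> 'tta set"
    and Ttb :: "'m \<Rightarrow> 'tb set \<Rightarrow> 'ttb set"
    and Ttta :: "'m \<Rightarrow> 'tta set \<Rightarrow> 'ttta set"
    and F_a_a :: "'m \<Rightarrow> 'a set \<Rightarrow> 'a set \<Rightarrow> ('a \<Rightarrow> 'a) \<Rightarrow> ('ta \<Rightarrow> 'ta)"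
    and F_a_b :: "'m \<Rightarrow> 'a set \<Rightarrow> 'b set \<Rightarrow> ('a \<Rightarrow> 'b) \<Rightarrow> ('ta \<Rightarrow> 'tb)"
    and F_b_c :: "'m \<Rightarrow> 'b set \<Rightarrow> 'c set \<Rightarrow> ('b \<Rightarrow> 'c) \<Rightarrow> ('tb \<Rightarrow> 'tc)"
    and F_a_c :: "'m \<Rightarrow> 'a set \<Rightarrow> 'c set \<Rightarrow> ('a \<Rightarrow> 'c) \<Rightarrow> ('ta \<Rightarrow> 'tc)"
    and F_a_ta :: "'m \<Rightarrow> 'a set \<Rightarrow> 'ta set \<Rightarrow> ('a \<Rightarrow> 'ta) \<Rightarrow> ('ta \<Rightarrow> 'tta)"
    and F_ta_tb :: "'m \<Rightarrow> 'ta set \<Rightarrow> 'tb set \<Rightarrow> ('ta \<Rightarrow> 'tb) \<Rightarrow> ('tta \<Rightarrow> 'ttb)"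
    and F_tta_ta :: "'m \<Rightarrow> 'tta set \<Rightarrow> 'ta set \<Rightarrow> ('tta \<Rightarrow> 'ta) \<Rightarrow> ('ttta \<Rightarrow> 'tta)"
    and eta_a :: "'a set \<Rightarrow> 'a \<Rightarrow> 'ta"
    and eta_b :: "'b set \<Rightarrow> 'b \<Rightarrow> 'tb"
    and eta_ta :: "'ta set \<Rightarrow> 'ta \<Rightarrow> 'tta"
    and mu_a :: "'m \<Rightarrow> 'm \<Rightarrow> 'a set \<Rightarrow> 'tta \<Rightarrow> 'ta"
    and mu_b :: "'m \<Rightarrow> 'm \<Rightarrow> 'b set \<Rightarrow> 'ttb \<Rightarrow> 'tb"
    and mu_ta :: "'m \<Rightarrow> 'm \<Rightarrow> 'ta set \<Rightarrow> 'ttta \<Rightarrow> 'tta"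
  assumes T_functor:
      "m \<in> carrier M \<Longrightarrow>
       set_functor (Ta m) (Tb m) (Tc m) (F_a_a m) (F_a_b m) (F_b_c m) (F_a_c m)"
    and eta_natural:
      "nat_trans (\<lambda>X. X) (\<lambda>Y. Y) (\<lambda>X Y f. f)
                 (Ta (zero M)) (Tb (zero M)) (F_a_b (zero M)) eta_a eta_b"
    and mu_natural:
      "padd M m n = Some k \<Longrightarrow>
       nat_trans (\<lambda>X. Tta m (Ta n X)) (\<lambda>Y. Ttb m (Tb n Y))
                 (\<lambda>X Y f. F_ta_tb m (Ta n X) (Tb n Y) (F_a_b n X Y f))
                 (Ta k) (Tb k) (F_a_b k) (mu_a m n) (mu_b m n)"
    and mu_assoc:
      "\<lbrakk>padd M m n = Some mn; padd M mn p = Some k; padd M n p = Some np\<rbrakk> \<Longrightarrow>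
       compose (Ttta m (Tta n (Ta p X)))
               (mu_a m np X) (F_tta_ta m (Tta n (Ta p X)) (Ta np X) (mu_a n p X)) =
       compose (Ttta m (Tta n (Ta p X)))
               (mu_a mn p X) (mu_ta m n (Ta p X))"
    and mu_unit_right:
      "m \<in> carrier M \<Longrightarrow>
       compose (Ta m X) (mu_a m (zero M) X) (F_a_ta m X (Ta (zero M) X) (eta_a X)) =
       (\<lambda>t\<in>Ta m X. t)"
    and mu_unit_left:
      "m \<in> carrier M \<Longrightarrow>
       compose (Ta m X) (mu_a (zero M) m X) (eta_ta (Ta m X)) = (\<lambda>t\<in>Ta m X. t)"

locale extensible_graded_monad = graded_monad M Ta Tb Tc Tta Ttb Ttta
    F_a_a F_a_b F_b_c F_a_c F_a_ta F_ta_tb F_tta_ta eta_a eta_b eta_ta mu_a mu_b mu_ta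
  for M :: "('m, 'z) pcm_struct_scheme"
    and Ta :: "'m \<Rightarrow> 'a set \<Rightarrow> 'ta set"
    and Tb :: "'m \<Rightarrow> 'b set \<Rightarrow> 'tb set"
    and Tc Tta Ttb Ttta F_a_a F_a_b F_b_c F_a_c F_a_ta F_ta_tb F_tta_ta
      eta_a eta_b eta_ta mu_a mu_b mu_ta +
  fixes xi_a :: "'m \<Rightarrow> 'm \<Rightarrow> 'a set \<Rightarrow> 'ta \<Rightarrow> 'ta"
    and xi_b :: "'m \<Rightarrow> 'm \<Rightarrow> 'b set \<Rightarrow> 'tb \<Rightarrow> 'tb"
  assumes xi_natural:
      "ple M m n \<Longrightarrow>
       nat_trans (Ta m) (Tb m) (F_a_b m) (Ta n) (Tb n) (F_a_b n) (xi_a m n) (xi_b m n)"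
    and xi_refl: "m \<in> carrier M \<Longrightarrow> xi_a m m X = (\<lambda>t\<in>Ta m X. t)"
    and xi_trans:
      "\<lbrakk>ple M m n; ple M n p\<rbrakk> \<Longrightarrow> compose (Ta m X) (xi_a n p X) (xi_a m n X) = xi_a m p X"

end

theory Submission
  imports Defs
begin

text \<open>
  Effect algebras are positive, so adjoining an absorbing element for \<open>undefined\<close> turns their
  partial sums into sums in a total commutative monoid, where definedness is carried along by
  equations. The monad laws then reduce to regrouping and exchanging finite sums and to pulling
  \<open>nabla\<close>, a homomorphism in each argument, through them.
\<close>

text \<open>The totalization has to obey monoid laws on a whole HOL type, while \<open>padd\<close>
  is undefined outside the carrier, even against \<open>zero A\<close>. Hence \<open>oadd\<close>
  tests for zero before it consults \<open>padd\<close>. This case split would break associativity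
  if nonzero \<open>a\<close> and \<open>b\<close> could have sum zero: for a value \<open>z\<close>
  outside the carrier, \<open>(a + b) + z\<close> would be \<open>z\<close> and
  \<open>a + (b + z)\<close> undefined. The zero-one law excludes such pairs. Equations between
  distributions are checked pointwise. Their two sides come with different supports, so pushforwards
  and products are first shown to be computable over every finite superset of the support; a common
  index set can then be chosen. The effect algebra structure of \<open>M\<close> supplies
  cancellation, which makes the difference in the extension well defined.\<close>

definition oadd :: "('a, 'z) pcm_struct_scheme \<Rightarrow> 'a option \<Rightarrow> 'a option \<Rightarrow> 'a option" where
  "oadd A x y =
     (if x = Some (zero A) then y else if y = Some (zero A) then x
      else Option.bind x (\<lambda>a. Option.bind y (padd A a)))"

abbreviation osum :: "('a, 'z) pcm_struct_scheme \<Rightarrow> ('x \<Rightarrow> 'a option) \<Rightarrow> 'x set \<Rightarrow> 'a option" where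
  "osum A \<equiv> comm_monoid_set.F (oadd A) (Some (zero A))"

section \<open>Total sums in an effect algebra\<close>

context effect_algebra
begin

lemma padd_zero_left: "a \<in> carrier A \<Longrightarrow> padd A (zero A) a = Some a"
  using padd_zero padd_commute by metis

lemma one_closed: "one A \<in> carrier A"
  unfolding one_def using orth_closed zero_closed by auto

text \<open>Positivity: if \<open>x + y = 0\<close> then \<open>(x + y) + 1\<close> is defined, so
  \<open>y + 1\<close> is defined by associativity, and the zero-one law forces
  \<open>y = 0\<close>. Commutativity takes care of \<open>x\<close>.\<close>

lemma padd_eq_zero:
  assumes "padd A a b = Some (zero A)"
  shows "a = zero A \<and> b = zero A"
proof -
  have *: "y = zero A" if "padd A x y = Some (zero A)" for x y
  proof -
    have "Option.bind (padd A x y) (\<lambda>d. padd A d (one A)) = Some (one A)"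
      using that padd_zero_left one_closed by simp
    then have "Option.bind (padd A y (one A)) (padd A x) = Some (one A)"
      using padd_assoc by metis
    then have "padd A y (one A) \<noteq> None"
      by (auto simp: bind_eq_Some_conv simp del: not_None_eq)
    then show ?thesis
      by (rule zero_one_law)
  qed
  then show ?thesis
    using assms padd_commute by metis
qed

lemma oadd_Some:
  assumes "a \<in> carrier A" and "b \<in> carrier A"
  shows "oadd A (Some a) (Some b) = padd A a b"
  using assms padd_zero padd_zero_left by (auto simp: oadd_def)

lemma oadd_None [simp]: "oadd A None y = None" "oadd A x None = None"
  by (auto simp: oadd_def)

lemma oadd_eq_zero_iff:
  "oadd A x y = Some (zero A) \<longleftrightarrow> x = Some (zero A) \<and> y = Some (zero A)"
  using padd_eq_zero by (auto simp: oadd_def bind_eq_Some_conv)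

lemma oadd_commute: "oadd A x y = oadd A y x"
  using padd_commute by (cases x; cases y) (auto simp: oadd_def)

text \<open>
  Positivity is what makes \<open>Some (zero A)\<close> neutral and the operation associative on the whole
  type, with no restriction to the carrier.
\<close>

lemma oadd_assoc: "oadd A (oadd A x y) z = oadd A x (oadd A y z)"
proof (cases "Some (zero A) \<in> {x, y, z} \<or> None \<in> {x, y, z}")
  case True
  then show ?thesis
    by (auto simp: oadd_def)
next
  case False
  then obtain a b c where abc: "x = Some a" "y = Some b" "z = Some c"
    by (metis insertCI not_None_eq)
  have ne: "oadd A x y \<noteq> Some (zero A)" "oadd A y z \<noteq> Some (zero A)"
    using False oadd_eq_zero_iff by auto
  have "oadd A (oadd A x y) z = Option.bind (oadd A x y) (\<lambda>d. padd A d c)"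
    using False ne abc unfolding oadd_def[of A "oadd A x y" z] by auto
  also have "\<dots> = Option.bind (oadd A y z) (padd A a)"
    using False abc padd_assoc[of a b c] by (auto simp: oadd_def)
  also have "\<dots> = oadd A x (oadd A y z)"
    using False ne abc unfolding oadd_def[of A x "oadd A y z"] by auto
  finally show ?thesis .
qed

sublocale osum: comm_monoid_set "oadd A" "Some (zero A)"
  by unfold_locales (use oadd_assoc oadd_commute in \<open>auto simp: oadd_def\<close>)

lemma oadd_closed:
  assumes "oadd A (Some a) (Some b) = Some c" and "a \<in> carrier A" and "b \<in> carrier A"
  shows "c \<in> carrier A"
  using assms padd_dom by (auto simp: oadd_Some)

lemma osum_closed:
  assumes "osum A f S = Some s" and "\<And>x a. x \<in> S \<Longrightarrow> f x = Some a \<Longrightarrow> a \<in> carrier A"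
  shows "s \<in> carrier A"
  using assms
proof (induction S arbitrary: s rule: infinite_finite_induct)
  case (insert x S)
  then have "oadd A (f x) (osum A f S) = Some s"
    by simp
  moreover from this obtain a b where "f x = Some a" "osum A f S = Some b"
    using oadd_None by (metis not_None_eq)
  ultimately show ?case
    using insert oadd_closed by (metis insertCI)
qed (use zero_closed in auto)

lemma osum_subset_defined:
  assumes "osum A f S \<noteq> None" and "finite S" and "T \<subseteq> S"
  shows "osum A f T \<noteq> None"
  using assms osum.subset_diff[of T S f] by (metis oadd_None(2))

text \<open>Definedness by domination: the larger sum splits into two sums, and \<open>None\<close>
  absorbs. The double sums of \<open>nabla\<close> obtain their definedness in this way.\<close>

lemma osum_summand_defined:
  assumes "osum A (\<lambda>x. oadd A (f x) (g x)) S \<noteq> None"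
  shows "osum A f S \<noteq> None"
  using assms oadd_None(1) by (metis osum.distrib)

text \<open>Bridge from the sums in the definitions to the total ones. It holds for values in the
  carrier, since \<open>oadd\<close> bypasses \<open>padd\<close> as soon as one argument is
  zero.\<close>

lemma psum_eq_osum:
  assumes "finite S" and "f \<in> S \<rightarrow> carrier A"
  shows "psum A f S = osum A (\<lambda>x. Some (f x)) S"
  using assms
proof (induction rule: finite_induct)
  case (insert x S)
  interpret comp_fun_commute "\<lambda>x acc. Option.bind acc (padd A (f x))"
  proof
    fix x y
    have "Option.bind (padd A (f x) c) (padd A (f y)) = Option.bind (padd A (f y) c) (padd A (f x))" for c
      using padd_assoc[of "f y" "f x" c] padd_assoc[of "f x" "c" "f y"] padd_commute
      by (metis (no_types, lifting) ext)
    then show "(\<lambda>acc. Option.bind acc (padd A (f y))) \<circ> (\<lambda>acc. Option.bind acc (padd A (f x))) =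
      (\<lambda>acc. Option.bind acc (padd A (f x))) \<circ> (\<lambda>acc. Option.bind acc (padd A (f y)))"
      by (intro ext) (auto simp: bind_assoc)
  qed
  have "psum A f (insert x S) = Option.bind (psum A f S) (padd A (f x))"
    unfolding psum_def using insert.hyps by simp
  also have "\<dots> = Option.bind (osum A (\<lambda>x. Some (f x)) S) (padd A (f x))"
    using insert by simp
  also have "\<dots> = oadd A (Some (f x)) (osum A (\<lambda>x. Some (f x)) S)"
  proof (cases "osum A (\<lambda>x. Some (f x)) S")
    case (Some s)
    then have "s \<in> carrier A"
      using insert.prems by (intro osum_closed[OF Some]) auto
    then show ?thesis
      using Some insert.prems oadd_Some by auto
  qed simp
  finally show ?case
    using insert.hyps by simp
qed (simp add: psum_def)

text \<open>If \<open>d\<close> is the complement of \<open>c\<close>, every solution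
  \<open>x\<close> of \<open>a + x = c\<close> is the complement of \<open>a + d\<close>, so
  \<open>a\<close> and \<open>c\<close> determine it.\<close>

lemma padd_cancel:
  assumes "padd A a b = Some c" and "padd A a b' = Some c"
  shows "b = b'"
proof -
  obtain d where d: "padd A c d = Some (one A)"
    using assms padd_dom orth_sum by blast
  have *: "\<exists>e. padd A a d = Some e \<and> x = orth A e" if "padd A a x = Some c" for x
  proof -
    have "Option.bind (padd A x a) (\<lambda>c. padd A c d) = Some (one A)"
      using that d padd_commute by simp
    then have "Option.bind (padd A a d) (padd A x) = Some (one A)"
      using padd_assoc by metis
    then obtain e where "padd A a d = Some e" "padd A x e = Some (one A)"
      by (auto simp: bind_eq_Some_conv)
    then show ?thesis
      using orth_unique padd_commute by metis
  qed
  show ?thesis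
    using *[OF assms(1)] *[OF assms(2)] by auto
qed

lemma pdiff_eq: "padd A a k = Some c \<Longrightarrow> pdiff A c a = k"
  unfolding pdiff_def using padd_cancel by blast

section \<open>Finitely supported distributions and their pushforward\<close>

text \<open>A finite set containing the support is enough. Homomorphisms may send nonzero weights to
  zero, so for a constructed distribution an upper bound on the support is what is at hand.\<close>

lemma fdistI:
  assumes "\<Delta> \<in> X \<rightarrow>\<^sub>E carrier A" and "finite S" and "\<And>x. x \<in> X \<Longrightarrow> x \<notin> S \<Longrightarrow> \<Delta> x = zero A"
    and "osum A (\<lambda>x. Some (\<Delta> x)) S \<noteq> None"
  shows "\<Delta> \<in> fdist A X"
proof -
  have S: "supp A X \<Delta> \<subseteq> S"
    using assms(3) by (auto simp: supp_def)
  then have fin: "finite (supp A X \<Delta>)"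
    using assms(2) finite_subset by blast
  moreover have "psum A \<Delta> (supp A X \<Delta>) = osum A (\<lambda>x. Some (\<Delta> x)) (supp A X \<Delta>)"
    using fin assms(1) by (intro psum_eq_osum) (auto simp: supp_def)
  moreover have "osum A (\<lambda>x. Some (\<Delta> x)) (supp A X \<Delta>) \<noteq> None"
    by (rule osum_subset_defined[OF assms(4,2) S])
  ultimately show ?thesis
    using assms(1) by (simp add: fdist_def)
qed

lemma fdist_cases:
  assumes "\<Delta> \<in> fdist A X"
  obtains s where "\<Delta> \<in> X \<rightarrow>\<^sub>E carrier A" and "finite (supp A X \<Delta>)"
    and "osum A (\<lambda>x. Some (\<Delta> x)) (supp A X \<Delta>) = Some s" and "s \<in> carrier A"
proof -
  have \<Delta>: "\<Delta> \<in> X \<rightarrow>\<^sub>E carrier A" and fin: "finite (supp A X \<Delta>)"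
    and ne: "psum A \<Delta> (supp A X \<Delta>) \<noteq> None"
    using assms by (auto simp: fdist_def)
  have "osum A (\<lambda>x. Some (\<Delta> x)) (supp A X \<Delta>) \<noteq> None"
    using ne \<Delta> fin by (subst psum_eq_osum[symmetric]) (auto simp: supp_def)
  then obtain s where s: "osum A (\<lambda>x. Some (\<Delta> x)) (supp A X \<Delta>) = Some s"
    by auto
  moreover have "s \<in> carrier A"
    using \<Delta> by (intro osum_closed[OF s]) (auto simp: supp_def)
  ultimately show thesis
    using that \<Delta> fin by blast
qed

lemma fdist_closed: "\<Delta> \<in> fdist A X \<Longrightarrow> x \<in> X \<Longrightarrow> \<Delta> x \<in> carrier A"
  by (auto simp: fdist_def)

lemma fdist_osum_defined:
  assumes "\<Delta> \<in> fdist A X" and "finite S" and "S \<subseteq> X"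
  shows "osum A (\<lambda>x. Some (\<Delta> x)) S \<noteq> None"
proof (rule fdist_cases[OF assms(1)])
  fix s
  assume fin: "finite (supp A X \<Delta>)" and s: "osum A (\<lambda>x. Some (\<Delta> x)) (supp A X \<Delta>) = Some s"
  have "osum A (\<lambda>x. Some (\<Delta> x)) (S \<inter> supp A X \<Delta>) \<noteq> None"
    using s fin osum_subset_defined[of _ "supp A X \<Delta>"] by auto
  moreover have "osum A (\<lambda>x. Some (\<Delta> x)) (S \<inter> supp A X \<Delta>) = osum A (\<lambda>x. Some (\<Delta> x)) S"
    using assms by (intro osum.mono_neutral_left) (auto simp: supp_def)
  ultimately show ?thesis
    by simp
qed

text \<open>The support may be enlarged by points of weight zero, so that both sides of an equation
  can be summed over the same \<open>S\<close>. The sum is also shown to be defined, which justifies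
  \<open>the\<close> in \<open>fdist_map\<close>.\<close>

lemma fdist_map_value:
  assumes "\<Delta> \<in> fdist A X" and "finite S" and "supp A X \<Delta> \<subseteq> S" and "S \<subseteq> X" and "y \<in> Y"
  shows "osum A (\<lambda>x. Some (\<Delta> x)) {x \<in> S. f x = y} = Some (fdist_map A X Y f \<Delta> y)"
proof -
  have fin: "finite (supp A X \<Delta>)"
    using assms by (auto simp: fdist_def)
  have "osum A (\<lambda>x. Some (\<Delta> x)) {x \<in> S. f x = y}
      = osum A (\<lambda>x. Some (\<Delta> x)) {x \<in> supp A X \<Delta>. f x = y}"
    using assms by (intro osum.mono_neutral_right) (auto simp: supp_def)
  also have "\<dots> = psum A \<Delta> {x \<in> supp A X \<Delta>. f x = y}"
    using finite_subset[OF _ fin, of "{x \<in> supp A X \<Delta>. f x = y}"] assms(1)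
    by (subst psum_eq_osum) (auto simp: supp_def fdist_def)
  finally have eq: "osum A (\<lambda>x. Some (\<Delta> x)) {x \<in> S. f x = y}
      = psum A \<Delta> {x \<in> supp A X \<Delta>. f x = y}" .
  have "osum A (\<lambda>x. Some (\<Delta> x)) {x \<in> S. f x = y} \<noteq> None"
    using assms by (intro fdist_osum_defined) auto
  then show ?thesis
    using assms eq by (auto simp: fdist_map_def)
qed

lemma fdist_map_closed:
  assumes "\<Delta> \<in> fdist A X" and "f \<in> X \<rightarrow> Y"
  shows "fdist_map A X Y f \<Delta> \<in> fdist A Y"
    and "supp A Y (fdist_map A X Y f \<Delta>) \<subseteq> f ` supp A X \<Delta>"
proof -
  let ?S = "supp A X \<Delta>" and ?g = "fdist_map A X Y f \<Delta>"
  obtain s where \<Delta>: "\<Delta> \<in> X \<rightarrow>\<^sub>E carrier A" and fin: "finite ?S"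
    and s: "osum A (\<lambda>x. Some (\<Delta> x)) ?S = Some s"
    using assms by (auto elim: fdist_cases)
  have v: "osum A (\<lambda>x. Some (\<Delta> x)) {x \<in> ?S. f x = y} = Some (?g y)" if "y \<in> Y" for y
    using assms fin that by (intro fdist_map_value) (auto simp: supp_def)
  have z: "?g y = zero A" if "y \<in> Y" "y \<notin> f ` ?S" for y
  proof -
    have "{x \<in> ?S. f x = y} = {}"
      using that by auto
    with v[OF that(1)] show ?thesis
      by simp
  qed
  show "supp A Y ?g \<subseteq> f ` ?S"
    using z by (auto simp: supp_def)
  have "osum A (\<lambda>y. Some (?g y)) (f ` ?S)
      = osum A (\<lambda>y. osum A (\<lambda>x. Some (\<Delta> x)) {x \<in> ?S. f x = y}) (f ` ?S)"
  proof (rule osum.cong)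
    fix y
    assume "y \<in> f ` ?S"
    then have "y \<in> Y"
      using assms(2) by (auto simp: supp_def)
    then show "Some (?g y) = osum A (\<lambda>x. Some (\<Delta> x)) {x \<in> ?S. f x = y}"
      using v by simp
  qed simp
  \<comment> \<open>Summing over the fibres of \<open>f\<close> regroups the original sum, so the
    pushforward keeps the total mass \<open>s\<close>.\<close>
  also have "\<dots> = Some s"
    using osum.image_gen[OF fin] s by metis
  finally have t: "osum A (\<lambda>y. Some (?g y)) (f ` ?S) \<noteq> None"
    by simp
  have "?g y \<in> carrier A" if "y \<in> Y" for y
    using \<Delta> by (intro osum_closed[OF v[OF that]]) (auto simp: supp_def)
  then have "?g \<in> Y \<rightarrow>\<^sub>E carrier A"
    using assms(1) by (auto simp: fdist_map_def)
  then show "?g \<in> fdist A Y"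
    using z t fin by (intro fdistI[of _ _ "f ` ?S"]) auto
qed

lemma fdist_eqI:
  assumes "\<Delta> \<in> fdist A X" and "\<Gamma> \<in> fdist A X" and "\<And>x. x \<in> X \<Longrightarrow> \<Delta> x = \<Gamma> x"
  shows "\<Delta> = \<Gamma>"
  using assms by (intro extensionalityI[of _ X]) (auto simp: fdist_def PiE_def)

lemma fdist_map_extensional: "fdist_map A X Y f \<in> extensional (fdist A X)"
  by (simp add: fdist_map_def)

lemma fdist_map_ident:
  assumes "\<Delta> \<in> fdist A X"
  shows "fdist_map A X X (\<lambda>x\<in>X. x) \<Delta> = \<Delta>"
proof (rule fdist_eqI[of _ X])
  show "fdist_map A X X (\<lambda>x\<in>X. x) \<Delta> \<in> fdist A X"
    using assms by (intro fdist_map_closed) auto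
  fix y
  assume y: "y \<in> X"
  \<comment> \<open>With \<open>y\<close> inserted, the fibre over \<open>y\<close> is
    \<open>{y}\<close> even if \<open>\<Delta> y\<close> is zero.\<close>
  let ?S = "insert y (supp A X \<Delta>)"
  have "osum A (\<lambda>x. Some (\<Delta> x)) {x \<in> ?S. (\<lambda>x\<in>X. x) x = y}
      = Some (fdist_map A X X (\<lambda>x\<in>X. x) \<Delta> y)"
    using assms y by (intro fdist_map_value) (auto simp: supp_def fdist_def)
  moreover have "{x \<in> ?S. (\<lambda>x\<in>X. x) x = y} = {y}"
    using y by (auto simp: supp_def)
  ultimately show "fdist_map A X X (\<lambda>x\<in>X. x) \<Delta> y = \<Delta> y"
    by simp
qed (use assms in auto)

end

section \<open>Homomorphisms and finite sums\<close>

text \<open>Homomorphisms preserve sums that are defined, hence the hypothesis with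
  \<open>Some s\<close>: the sum in \<open>B\<close> may exist when the one in \<open>A\<close> does
  not. This is the tool that moves \<open>nabla\<close> across a sum in either argument.\<close>

lemma pcm_hom_osum:
  assumes "effect_algebra A" and "effect_algebra B" and "pcm_hom A B h"
    and "f \<in> S \<rightarrow> carrier A" and "osum A (\<lambda>x. Some (f x)) S = Some s"
  shows "osum B (\<lambda>x. Some (h (f x))) S = Some (h s)"
proof -
  interpret A: effect_algebra A by fact
  interpret B: effect_algebra B by fact
  show ?thesis
    using assms(4,5)
  proof (induction S arbitrary: s rule: infinite_finite_induct)
    case (insert x S)
    then have *: "oadd A (Some (f x)) (osum A (\<lambda>x. Some (f x)) S) = Some s"
      by simp
    then obtain t where t: "osum A (\<lambda>x. Some (f x)) S = Some t"
      by (metis A.oadd_None(2) not_None_eq)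
    have tc: "t \<in> carrier A"
      using insert.prems by (intro A.osum_closed[OF t]) auto
    then have "padd A (f x) t = Some s"
      using * t insert.prems A.oadd_Some by auto
    then have "padd B (h (f x)) (h t) = Some (h s)" "h (f x) \<in> carrier B" "h t \<in> carrier B"
      using assms(3) insert.prems tc by (auto simp: pcm_hom_def)
    moreover have "osum B (\<lambda>x. Some (h (f x))) S = Some (h t)"
      using insert t by auto
    ultimately show ?case
      using insert.hyps B.oadd_Some by simp
  qed (use assms(3) in \<open>auto simp: pcm_hom_def\<close>)
qed

text \<open>Integration along a pushforward: \<open>h a y\<close> plays the role of the integrand at \<open>y\<close> with weight \<open>a\<close>.\<close>

lemma osum_fdist_map:
  assumes "effect_algebra A" and "effect_algebra B"
    and "\<And>y. y \<in> Y \<Longrightarrow> pcm_hom A B (\<lambda>a. h a y)"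
    and "\<Delta> \<in> fdist A X" and "f \<in> X \<rightarrow> Y"
    and "finite S" and "supp A X \<Delta> \<subseteq> S" and "S \<subseteq> X"
  shows "osum B (\<lambda>y. Some (h (fdist_map A X Y f \<Delta> y) y)) (f ` S)
       = osum B (\<lambda>x. Some (h (\<Delta> x) (f x))) S"
proof -
  interpret A: effect_algebra A by fact
  interpret B: effect_algebra B by fact
  have "osum B (\<lambda>y. Some (h (fdist_map A X Y f \<Delta> y) y)) (f ` S)
      = osum B (\<lambda>y. osum B (\<lambda>x. Some (h (\<Delta> x) (f x))) {x \<in> S. f x = y}) (f ` S)"
  proof (rule B.osum.cong)
    fix y
    assume "y \<in> f ` S"
    then have y: "y \<in> Y"
      using assms by auto
    \<comment> \<open>On the fibre over \<open>y\<close> the second argument of \<open>h\<close> is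
      constantly \<open>y\<close>, so a single homomorphism is applied to the fibre sum.\<close>
    have "osum B (\<lambda>x. Some (h (\<Delta> x) y)) {x \<in> S. f x = y} = Some (h (fdist_map A X Y f \<Delta> y) y)"
      using assms(4-) A.fdist_closed[OF assms(4)] y
      by (intro pcm_hom_osum[OF assms(1,2) assms(3)[OF y]] A.fdist_map_value) auto
    then show "Some (h (fdist_map A X Y f \<Delta> y) y)
        = osum B (\<lambda>x. Some (h (\<Delta> x) (f x))) {x \<in> S. f x = y}"
      by (auto intro: B.osum.cong)
  qed simp
  also have "\<dots> = osum B (\<lambda>x. Some (h (\<Delta> x) (f x))) S"
    using B.osum.image_gen[OF assms(6)] by metis
  finally show ?thesis .
qed

section \<open>Composition of pushforwards and the functor laws\<close>

context effect_algebra
begin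

lemma fdist_map_compose:
  assumes "\<Delta> \<in> fdist A X" and "f \<in> X \<rightarrow> Y" and "g \<in> Y \<rightarrow> Z"
  shows "fdist_map A X Z (compose X g f) \<Delta> = fdist_map A Y Z g (fdist_map A X Y f \<Delta>)"
proof (rule fdist_eqI[of _ Z])
  have m: "fdist_map A X Y f \<Delta> \<in> fdist A Y"
    using assms fdist_map_closed by blast
  show "fdist_map A X Z (compose X g f) \<Delta> \<in> fdist A Z"
    using assms by (intro fdist_map_closed) (auto simp: compose_def)
  show "fdist_map A Y Z g (fdist_map A X Y f \<Delta>) \<in> fdist A Z"
    using assms m by (intro fdist_map_closed) auto
  fix z
  assume z: "z \<in> Z"
  let ?S = "supp A X \<Delta>" and ?W = "{x \<in> supp A X \<Delta>. g (f x) = z}"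
  have fin: "finite ?S" and sub: "?S \<subseteq> X"
    using assms by (auto simp: fdist_def supp_def)
  have "Some (fdist_map A Y Z g (fdist_map A X Y f \<Delta>) z)
      = osum A (\<lambda>y. Some (fdist_map A X Y f \<Delta> y)) {y \<in> f ` ?S. g y = z}"
    using m fdist_map_closed[OF assms(1,2)] fin sub z assms
    by (intro fdist_map_value[symmetric]) auto
  also have "{y \<in> f ` ?S. g y = z} = f ` ?W"
    by auto
  also have "osum A (\<lambda>y. Some (fdist_map A X Y f \<Delta> y)) (f ` ?W)
      = osum A (\<lambda>y. osum A (\<lambda>x. Some (\<Delta> x)) {x \<in> ?W. f x = y}) (f ` ?W)"
  proof (rule osum.cong)
    fix y
    assume y: "y \<in> f ` ?W"
    then have "osum A (\<lambda>x. Some (\<Delta> x)) {x \<in> ?S. f x = y} = Some (fdist_map A X Y f \<Delta> y)"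
      using assms fin sub by (intro fdist_map_value) auto
    \<comment> \<open>Within \<open>?S\<close>, membership in \<open>?W\<close> depends on
      \<open>f x\<close> alone, so a fibre of \<open>f\<close> that meets \<open>?W\<close> lies
      inside it.\<close>
    moreover have "{x \<in> ?S. f x = y} = {x \<in> ?W. f x = y}"
      using y by auto
    ultimately show "Some (fdist_map A X Y f \<Delta> y) = osum A (\<lambda>x. Some (\<Delta> x)) {x \<in> ?W. f x = y}"
      by simp
  qed simp
  also have "\<dots> = osum A (\<lambda>x. Some (\<Delta> x)) ?W"
    using fin osum.image_gen[of ?W "\<lambda>x. Some (\<Delta> x)" f] by simp
  also have "?W = {x \<in> ?S. compose X g f x = z}"
    using sub by (auto simp: compose_def)
  also have "osum A (\<lambda>x. Some (\<Delta> x)) \<dots> = Some (fdist_map A X Z (compose X g f) \<Delta> z)"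
    using assms fin sub z by (intro fdist_map_value) auto
  finally show "fdist_map A X Z (compose X g f) \<Delta> z = fdist_map A Y Z g (fdist_map A X Y f \<Delta>) z"
    by simp
qed

lemma set_functor_fdist:
  "set_functor (fdist A) (fdist A) (fdist A) (fdist_map A) (fdist_map A) (fdist_map A) (fdist_map A)"
  unfolding set_functor_def
proof (intro conjI allI ballI)
  fix X :: "'x set" and Y :: "'y set" and f
  assume "f \<in> X \<rightarrow>\<^sub>E Y"
  then show "fdist_map A X Y f \<in> fdist A X \<rightarrow>\<^sub>E fdist A Y"
    using fdist_map_closed(1)[of _ X f Y] by (auto simp: fdist_map_def)
next
  fix X :: "'x set"
  show "fdist_map A X X (\<lambda>x\<in>X. x) = (\<lambda>t\<in>fdist A X. t)"
    using fdist_map_ident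
    by (intro extensionalityI[of _ "fdist A X"]) (auto simp: fdist_map_extensional)
next
  fix X :: "'x set" and Y :: "'y set" and Z :: "'w set" and f g
  assume "f \<in> X \<rightarrow>\<^sub>E Y" "g \<in> Y \<rightarrow>\<^sub>E Z"
  then show "fdist_map A X Z (compose X g f)
      = compose (fdist A X) (fdist_map A Y Z g) (fdist_map A X Y f)"
    using fdist_map_compose[of _ X f Y g Z]
    by (intro extensionalityI[of _ "fdist A X"]) (auto simp: fdist_map_extensional compose_eq PiE_def)
qed

end

section \<open>Postcomposition with a homomorphism\<close>

lemma pcm_hom_zero: "pcm_hom A B h \<Longrightarrow> h (zero A) = zero B"
  by (simp add: pcm_hom_def)

lemma pcm_hom_closed: "pcm_hom A B h \<Longrightarrow> a \<in> carrier A \<Longrightarrow> h a \<in> carrier B"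
  by (auto simp: pcm_hom_def)

text \<open>The total mass \<open>s\<close> becomes \<open>h s\<close>, hence stays defined. The
  extension is the instance in which \<open>h\<close> multiplies by a top element on the
  right.\<close>

lemma fdist_hom:
  assumes "effect_algebra A" and "effect_algebra B" and "pcm_hom A B h" and "\<Delta> \<in> fdist A X"
  shows "(\<lambda>x\<in>X. h (\<Delta> x)) \<in> fdist B X"
    and "supp B X (\<lambda>x\<in>X. h (\<Delta> x)) \<subseteq> supp A X \<Delta>"
proof -
  interpret A: effect_algebra A by fact
  interpret B: effect_algebra B by fact
  let ?S = "supp A X \<Delta>"
  obtain s where \<Delta>: "\<Delta> \<in> X \<rightarrow>\<^sub>E carrier A" and fin: "finite ?S"
    and s: "osum A (\<lambda>x. Some (\<Delta> x)) ?S = Some s"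
    using assms(4) by (auto elim: A.fdist_cases)
  have "osum B (\<lambda>x. Some (h (\<Delta> x))) ?S = Some (h s)"
    using \<Delta> s by (intro pcm_hom_osum[OF assms(1-3)]) (auto simp: supp_def)
  also have "osum B (\<lambda>x. Some (h (\<Delta> x))) ?S = osum B (\<lambda>x. Some ((\<lambda>x\<in>X. h (\<Delta> x)) x)) ?S"
    by (rule B.osum.cong) (auto simp: supp_def)
  finally show "(\<lambda>x\<in>X. h (\<Delta> x)) \<in> fdist B X"
    using \<Delta> fin pcm_hom_zero[OF assms(3)] pcm_hom_closed[OF assms(3)]
    by (intro B.fdistI[of _ _ ?S]) (auto simp: supp_def)
  show "supp B X (\<lambda>x\<in>X. h (\<Delta> x)) \<subseteq> supp A X \<Delta>"
    using pcm_hom_zero[OF assms(3)] by (auto simp: supp_def)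
qed

lemma fdist_map_hom:
  assumes "effect_algebra A" and "effect_algebra B" and "pcm_hom A B h"
    and "\<Delta> \<in> fdist A X" and "f \<in> X \<rightarrow> Y"
  shows "fdist_map B X Y f (\<lambda>x\<in>X. h (\<Delta> x)) = (\<lambda>y\<in>Y. h (fdist_map A X Y f \<Delta> y))"
proof -
  interpret A: effect_algebra A by fact
  interpret B: effect_algebra B by fact
  let ?S = "supp A X \<Delta>"
  have fin: "finite ?S" and sub: "?S \<subseteq> X"
    using assms(4) by (auto simp: fdist_def supp_def)
  show ?thesis
  proof (rule B.fdist_eqI[of _ Y])
    show "fdist_map B X Y f (\<lambda>x\<in>X. h (\<Delta> x)) \<in> fdist B Y"
      using fdist_hom[OF assms(1-4)] assms(5) by (intro B.fdist_map_closed)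
    show "(\<lambda>y\<in>Y. h (fdist_map A X Y f \<Delta> y)) \<in> fdist B Y"
      using assms by (intro fdist_hom[OF assms(1-3)] A.fdist_map_closed)
    fix y
    assume y: "y \<in> Y"
    have "Some (fdist_map B X Y f (\<lambda>x\<in>X. h (\<Delta> x)) y)
        = osum B (\<lambda>x. Some ((\<lambda>x\<in>X. h (\<Delta> x)) x)) {x \<in> ?S. f x = y}"
      using fdist_hom[OF assms(1-4)] fin sub y by (intro B.fdist_map_value[symmetric])
    also have "\<dots> = osum B (\<lambda>x. Some (h (\<Delta> x))) {x \<in> ?S. f x = y}"
      by (rule B.osum.cong) (auto simp: supp_def)
    also have "\<dots> = Some (h (fdist_map A X Y f \<Delta> y))"
      using assms(4) fin sub y A.fdist_closed[OF assms(4)]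
      by (intro pcm_hom_osum[OF assms(1-3)] A.fdist_map_value) auto
    finally show "fdist_map B X Y f (\<lambda>x\<in>X. h (\<Delta> x)) y = (\<lambda>y\<in>Y. h (fdist_map A X Y f \<Delta> y)) y"
      using y by simp
  qed
qed

section \<open>Multiplication: definedness, naturality and associativity\<close>

context graded_effect_monoid
begin

lemma effect_algebras:
  assumes "padd M m n = Some k"
  shows "effect_algebra (E m)" and "effect_algebra (E n)" and "effect_algebra (E k)"
  using assms padd_dom effect_algebra_E by blast+

lemma padd_zero_left: "m \<in> carrier M \<Longrightarrow> padd M (zero M) m = Some m"
  using padd_zero padd_commute by metis

text \<open>An effect morphism preserves zero and complements, hence the top element. This
  identifies the scalar in the unit laws of \<open>nabla\<close> with the weight used by
  \<open>fdist_unit\<close>.\<close>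

lemma eta_True: "eta True = one (E (zero M))"
proof -
  have in_two: "False \<in> carrier two"
    by (simp add: two_def)
  have "eta (orth two False) = orth (E (zero M)) (eta False)" "eta (zero two) = zero (E (zero M))"
    using eta_morphism unfolding effect_morphism_def pcm_hom_def by (blast intro: in_two)+
  moreover have "orth two False = True" "zero two = False"
    by (simp_all add: two_def)
  ultimately show ?thesis
    by (simp add: one_def)
qed

lemma nabla_hom_left:
  "padd M m n = Some k \<Longrightarrow> b \<in> carrier (E n) \<Longrightarrow> pcm_hom (E m) (E k) (\<lambda>a. nabla m n a b)"
  using nabla_bimorphism by (auto simp: bimorphism_def)

lemma nabla_hom_right:
  "padd M m n = Some k \<Longrightarrow> a \<in> carrier (E m) \<Longrightarrow> pcm_hom (E n) (E k) (nabla m n a)"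
  using nabla_bimorphism by (auto simp: bimorphism_def)

lemma nabla_closed:
  "padd M m n = Some k \<Longrightarrow> a \<in> carrier (E m) \<Longrightarrow> b \<in> carrier (E n) \<Longrightarrow> nabla m n a b \<in> carrier (E k)"
  using nabla_hom_left pcm_hom_closed by fastforce

lemma nabla_zero_left:
  "padd M m n = Some k \<Longrightarrow> b \<in> carrier (E n) \<Longrightarrow> nabla m n (zero (E m)) b = zero (E k)"
  using nabla_hom_left pcm_hom_zero by fastforce

lemma nabla_zero_right:
  "padd M m n = Some k \<Longrightarrow> a \<in> carrier (E m) \<Longrightarrow> nabla m n a (zero (E n)) = zero (E k)"
  using nabla_hom_right pcm_hom_zero by fastforce

text \<open>
  Bounding each inner sum by \<open>1\<close>, the double sum is a summand of \<open>nabla m n (\<Sum> \<Xi> \<Delta>) 1\<close>.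
\<close>

lemma osum_nabla_defined:
  assumes k: "padd M m n = Some k" and \<Xi>: "\<Xi> \<in> fdist (E m) (fdist (E n) X)"
    and S: "finite S" "S \<subseteq> fdist (E n) X" and U: "finite U" "U \<subseteq> X"
  shows "osum (E k) (\<lambda>x. osum (E k) (\<lambda>\<Delta>. Some (nabla m n (\<Xi> \<Delta>) (\<Delta> x))) S) U \<noteq> None"
proof -
  interpret m: effect_algebra "E m" using effect_algebras[OF k] by simp
  interpret n: effect_algebra "E n" using effect_algebras[OF k] by simp
  interpret k: effect_algebra "E k" using effect_algebras[OF k] by simp
  \<comment> \<open>The mass of \<open>\<Delta>\<close> on \<open>U\<close>; its complement in
    \<open>E n\<close> later pads it to one.\<close>
  define t where "t \<Delta> = the (osum (E n) (\<lambda>x. Some (\<Delta> x)) U)" for \<Delta>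
  have t: "osum (E n) (\<lambda>x. Some (\<Delta> x)) U = Some (t \<Delta>)" and tc: "t \<Delta> \<in> carrier (E n)"
    if "\<Delta> \<in> S" for \<Delta>
  proof -
    have \<Delta>: "\<Delta> \<in> fdist (E n) X"
      using that S by auto
    then show t: "osum (E n) (\<lambda>x. Some (\<Delta> x)) U = Some (t \<Delta>)"
      unfolding t_def using n.fdist_osum_defined[OF \<Delta> U] by auto
    show "t \<Delta> \<in> carrier (E n)"
      using n.fdist_closed[OF \<Delta>] U by (intro n.osum_closed[OF t]) auto
  qed
  have \<Xi>c: "\<Xi> \<Delta> \<in> carrier (E m)" if "\<Delta> \<in> S" for \<Delta>
    using that S m.fdist_closed[OF \<Xi>] by auto
  \<comment> \<open>With the summation over \<open>x\<close> innermost, additivity of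
    \<open>nabla\<close> in its right argument contracts it to the mass
    \<open>t \<Delta>\<close>.\<close>
  have "osum (E k) (\<lambda>x. osum (E k) (\<lambda>\<Delta>. Some (nabla m n (\<Xi> \<Delta>) (\<Delta> x))) S) U
      = osum (E k) (\<lambda>\<Delta>. osum (E k) (\<lambda>x. Some (nabla m n (\<Xi> \<Delta>) (\<Delta> x))) U) S"
    by (rule k.osum.swap)
  also have "\<dots> = osum (E k) (\<lambda>\<Delta>. Some (nabla m n (\<Xi> \<Delta>) (t \<Delta>))) S"
  proof (rule k.osum.cong)
    fix \<Delta>
    assume \<Delta>: "\<Delta> \<in> S"
    then have "\<Delta> \<in> U \<rightarrow> carrier (E n)"
      using S U n.fdist_closed[of \<Delta> X] by auto
    then show "osum (E k) (\<lambda>x. Some (nabla m n (\<Xi> \<Delta>) (\<Delta> x))) U = Some (nabla m n (\<Xi> \<Delta>) (t \<Delta>))"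
      using pcm_hom_osum[OF n.effect_algebra_axioms k.effect_algebra_axioms
          nabla_hom_right[OF k \<Xi>c[OF \<Delta>]] _ t[OF \<Delta>]] by simp
  qed simp
  also have "\<dots> \<noteq> None"
  proof (rule k.osum_summand_defined)
    obtain s where s: "osum (E m) (\<lambda>\<Delta>. Some (\<Xi> \<Delta>)) S = Some s"
      using m.fdist_osum_defined[OF \<Xi> S] by auto
    have "osum (E k) (\<lambda>\<Delta>. oadd (E k) (Some (nabla m n (\<Xi> \<Delta>) (t \<Delta>)))
          (Some (nabla m n (\<Xi> \<Delta>) (orth (E n) (t \<Delta>))))) S
        = osum (E k) (\<lambda>\<Delta>. Some (nabla m n (\<Xi> \<Delta>) (one (E n)))) S"
    proof (rule k.osum.cong)
      fix \<Delta>
      assume \<Delta>: "\<Delta> \<in> S"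
      have "padd (E k) (nabla m n (\<Xi> \<Delta>) (t \<Delta>)) (nabla m n (\<Xi> \<Delta>) (orth (E n) (t \<Delta>)))
          = Some (nabla m n (\<Xi> \<Delta>) (one (E n)))"
        using nabla_hom_right[OF k \<Xi>c[OF \<Delta>]] n.orth_sum[OF tc[OF \<Delta>]]
        unfolding pcm_hom_def by blast
      then show "oadd (E k) (Some (nabla m n (\<Xi> \<Delta>) (t \<Delta>)))
          (Some (nabla m n (\<Xi> \<Delta>) (orth (E n) (t \<Delta>)))) = Some (nabla m n (\<Xi> \<Delta>) (one (E n)))"
        using nabla_closed[OF k \<Xi>c[OF \<Delta>]] tc[OF \<Delta>] n.orth_closed k.oadd_Some by simp
    qed simp
    \<comment> \<open>Additivity in the left argument contracts the padded sum to a single product,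
      which is defined; \<open>s\<close> is the mass of \<open>\<Xi>\<close> on
      \<open>S\<close>.\<close>
    also have "\<dots> = Some (nabla m n s (one (E n)))"
      using \<Xi>c by (intro pcm_hom_osum[OF m.effect_algebra_axioms k.effect_algebra_axioms
          nabla_hom_left[OF k n.one_closed] _ s]) auto
    finally show "osum (E k) (\<lambda>\<Delta>. oadd (E k) (Some (nabla m n (\<Xi> \<Delta>) (t \<Delta>)))
          (Some (nabla m n (\<Xi> \<Delta>) (orth (E n) (t \<Delta>))))) S \<noteq> None"
      by simp
  qed
  finally show ?thesis .
qed

text \<open>Counterpart of \<open>fdist_map_value\<close>: outside the support of
  \<open>\<Xi>\<close> the left factor is zero and \<open>nabla\<close> annihilates, so enlarging
  the index set changes nothing.\<close>

lemma fdist_mult_value: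
  assumes k: "padd M m n = Some k" and \<Xi>: "\<Xi> \<in> fdist (E m) (fdist (E n) X)"
    and S: "finite S" "supp (E m) (fdist (E n) X) \<Xi> \<subseteq> S" "S \<subseteq> fdist (E n) X" and x: "x \<in> X"
  shows "osum (E k) (\<lambda>\<Delta>. Some (nabla m n (\<Xi> \<Delta>) (\<Delta> x))) S = Some (fdist_mult M E nabla m n X \<Xi> x)"
proof -
  interpret m: effect_algebra "E m" using effect_algebras[OF k] by simp
  interpret n: effect_algebra "E n" using effect_algebras[OF k] by simp
  interpret k: effect_algebra "E k" using effect_algebras[OF k] by simp
  let ?N = "\<lambda>\<Delta>. nabla m n (\<Xi> \<Delta>) (\<Delta> x)"
  let ?T = "supp (E m) (fdist (E n) X) \<Xi>"
  have \<Delta>c: "\<Delta> x \<in> carrier (E n)" if "\<Delta> \<in> S" for \<Delta>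
    using that S(3) n.fdist_closed[OF _ x] by auto
  have "osum (E k) (\<lambda>\<Delta>. Some (?N \<Delta>)) S = osum (E k) (\<lambda>\<Delta>. Some (?N \<Delta>)) ?T"
  proof (rule k.osum.mono_neutral_right[OF S(1,2)], rule ballI)
    fix \<Delta>
    assume \<Delta>: "\<Delta> \<in> S - ?T"
    then have "\<Xi> \<Delta> = zero (E m)"
      using S(3) by (auto simp: supp_def)
    then show "Some (?N \<Delta>) = Some (zero (E k))"
      using \<Delta> \<Delta>c nabla_zero_left[OF k] by simp
  qed
  also have "\<dots> = psum (E k) ?N ?T"
  proof (rule k.psum_eq_osum[symmetric])
    show "finite ?T"
      using S finite_subset by blast
    show "?N \<in> ?T \<rightarrow> carrier (E k)"
      using \<Delta>c S(2,3) m.fdist_closed[OF \<Xi>] by (auto intro!: nabla_closed[OF k])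
  qed
  finally have eq: "osum (E k) (\<lambda>\<Delta>. Some (?N \<Delta>)) S = psum (E k) ?N ?T" .
  \<comment> \<open>Definedness at one point is the double sum with \<open>U\<close> a
    singleton.\<close>
  have "osum (E k) (\<lambda>\<Delta>. Some (?N \<Delta>)) S \<noteq> None"
    using osum_nabla_defined[OF k \<Xi> S(1,3), of "{x}"] x by simp
  then show ?thesis
    using eq \<Xi> x k by (auto simp: fdist_mult_def)
qed

text \<open>Outside the union of the inner supports every factor \<open>\<Delta> x\<close> is zero,
  so the support is finite. The sum over that union is exactly the double sum already known to be
  defined.\<close>

lemma fdist_mult_closed:
  assumes k: "padd M m n = Some k" and \<Xi>: "\<Xi> \<in> fdist (E m) (fdist (E n) X)"
  shows "fdist_mult M E nabla m n X \<Xi> \<in> fdist (E k) X"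
    and "supp (E k) X (fdist_mult M E nabla m n X \<Xi>)
      \<subseteq> (\<Union>\<Delta>\<in>supp (E m) (fdist (E n) X) \<Xi>. supp (E n) X \<Delta>)"
proof -
  interpret m: effect_algebra "E m" using effect_algebras[OF k] by simp
  interpret n: effect_algebra "E n" using effect_algebras[OF k] by simp
  interpret k: effect_algebra "E k" using effect_algebras[OF k] by simp
  let ?S = "supp (E m) (fdist (E n) X) \<Xi>" and ?g = "fdist_mult M E nabla m n X \<Xi>"
  let ?U = "\<Union>\<Delta>\<in>?S. supp (E n) X \<Delta>"
  have S: "finite ?S" "?S \<subseteq> fdist (E n) X"
    using \<Xi> by (auto simp: fdist_def supp_def)
  then have U: "finite ?U" "?U \<subseteq> X"
    by (auto simp: fdist_def supp_def)
  have v: "osum (E k) (\<lambda>\<Delta>. Some (nabla m n (\<Xi> \<Delta>) (\<Delta> x))) ?S = Some (?g x)" if "x \<in> X" for x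
    using fdist_mult_value[OF k \<Xi> S(1) _ S(2) that] by simp
  have c: "nabla m n (\<Xi> \<Delta>) (\<Delta> x) \<in> carrier (E k)" if "\<Delta> \<in> ?S" "x \<in> X" for \<Delta> x
    using that S(2) m.fdist_closed[OF \<Xi>] n.fdist_closed[OF _ that(2)]
    by (intro nabla_closed[OF k]) auto
  have z: "?g x = zero (E k)" if "x \<in> X" "x \<notin> ?U" for x
  proof -
    have "osum (E k) (\<lambda>\<Delta>. Some (nabla m n (\<Xi> \<Delta>) (\<Delta> x))) ?S = Some (zero (E k))"
    proof (rule k.osum.neutral, rule ballI)
      fix \<Delta>
      assume "\<Delta> \<in> ?S"
      moreover from this have "\<Delta> x = zero (E n)"
        using that by (auto simp: supp_def)
      ultimately show "Some (nabla m n (\<Xi> \<Delta>) (\<Delta> x)) = Some (zero (E k))"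
        using S m.fdist_closed[OF \<Xi>] nabla_zero_right[OF k] by auto
    qed
    with v[OF that(1)] show ?thesis
      by simp
  qed
  show "supp (E k) X ?g \<subseteq> ?U"
    using z by (auto simp: supp_def)
  have "osum (E k) (\<lambda>x. Some (?g x)) ?U
      = osum (E k) (\<lambda>x. osum (E k) (\<lambda>\<Delta>. Some (nabla m n (\<Xi> \<Delta>) (\<Delta> x))) ?S) ?U"
    using v U(2) by (intro k.osum.cong) auto
  also have "\<dots> \<noteq> None"
    by (rule osum_nabla_defined[OF k \<Xi> S U])
  finally have d: "osum (E k) (\<lambda>x. Some (?g x)) ?U \<noteq> None" .
  have "?g x \<in> carrier (E k)" if "x \<in> X" for x
    using c that by (intro k.osum_closed[OF v[OF that]]) auto
  then have "?g \<in> X \<rightarrow>\<^sub>E carrier (E k)"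
    using \<Xi> by (auto simp: fdist_mult_def)
  then show "?g \<in> fdist (E k) X"
    using z d U by (intro k.fdistI[of _ _ ?U]) auto
qed

text \<open>At \<open>y\<close>, both sides are the double sum over the outer support and the points
  of \<open>?U\<close> above \<open>y\<close>, taken in the two possible orders.\<close>

lemma fdist_mult_natural:
  assumes k: "padd M m n = Some k" and \<Xi>: "\<Xi> \<in> fdist (E m) (fdist (E n) X)" and f: "f \<in> X \<rightarrow> Y"
  shows "fdist_map (E k) X Y f (fdist_mult M E nabla m n X \<Xi>)
    = fdist_mult M E nabla m n Y
        (fdist_map (E m) (fdist (E n) X) (fdist (E n) Y) (fdist_map (E n) X Y f) \<Xi>)"
proof -
  interpret m: effect_algebra "E m" using effect_algebras[OF k] by simp
  interpret n: effect_algebra "E n" using effect_algebras[OF k] by simp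
  interpret k: effect_algebra "E k" using effect_algebras[OF k] by simp
  let ?S = "supp (E m) (fdist (E n) X) \<Xi>" and ?g = "fdist_mult M E nabla m n X \<Xi>"
  let ?U = "\<Union>\<Delta>\<in>?S. supp (E n) X \<Delta>"
  let ?F = "fdist_map (E n) X Y f"
  let ?\<Psi> = "fdist_map (E m) (fdist (E n) X) (fdist (E n) Y) ?F \<Xi>"
  have S: "finite ?S" "?S \<subseteq> fdist (E n) X"
    using \<Xi> by (auto simp: fdist_def supp_def)
  then have U: "finite ?U" "?U \<subseteq> X"
    by (auto simp: fdist_def supp_def)
  have F: "?F \<in> fdist (E n) X \<rightarrow> fdist (E n) Y"
    using n.fdist_map_closed(1) f by blast
  note \<Psi> = m.fdist_map_closed[OF \<Xi> F]
  note g = fdist_mult_closed[OF k \<Xi>]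
  show ?thesis
  proof (rule k.fdist_eqI[of _ Y])
    show "fdist_map (E k) X Y f ?g \<in> fdist (E k) Y"
      using g f by (intro k.fdist_map_closed)
    show "fdist_mult M E nabla m n Y ?\<Psi> \<in> fdist (E k) Y"
      using \<Psi> by (intro fdist_mult_closed[OF k])
    fix y
    assume y: "y \<in> Y"
    let ?V = "{x \<in> ?U. f x = y}"
    have "Some (fdist_map (E k) X Y f ?g y) = osum (E k) (\<lambda>x. Some (?g x)) ?V"
      using g U y by (intro k.fdist_map_value[symmetric])
    also have "\<dots> = osum (E k) (\<lambda>x. osum (E k) (\<lambda>\<Delta>. Some (nabla m n (\<Xi> \<Delta>) (\<Delta> x))) ?S) ?V"
    proof (rule k.osum.cong)
      fix x
      assume "x \<in> ?V"
      then have "x \<in> X"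
        using U by auto
      then show "Some (?g x) = osum (E k) (\<lambda>\<Delta>. Some (nabla m n (\<Xi> \<Delta>) (\<Delta> x))) ?S"
        using fdist_mult_value[OF k \<Xi> S(1) _ S(2)] by simp
    qed simp
    also have "\<dots> = osum (E k) (\<lambda>\<Delta>. osum (E k) (\<lambda>x. Some (nabla m n (\<Xi> \<Delta>) (\<Delta> x))) ?V) ?S"
      by (rule k.osum.swap)
    also have "\<dots> = osum (E k) (\<lambda>\<Delta>. Some (nabla m n (\<Xi> \<Delta>) (?F \<Delta> y))) ?S"
    proof (rule k.osum.cong)
      fix \<Delta>
      assume \<Delta>: "\<Delta> \<in> ?S"
      then have \<Delta>': "\<Delta> \<in> fdist (E n) X"
        using S by auto
      \<comment> \<open>\<open>?U\<close> contains the support of every \<open>\<Delta>\<close> in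
        \<open>?S\<close>, so the one set \<open>?V\<close> computes all their pushforwards at
        \<open>y\<close>.\<close>
      have "osum (E n) (\<lambda>x. Some (\<Delta> x)) ?V = Some (?F \<Delta> y)"
        using \<Delta> U y by (intro n.fdist_map_value[OF \<Delta>']) auto
      moreover have "\<Delta> \<in> ?V \<rightarrow> carrier (E n)"
        using n.fdist_closed[OF \<Delta>'] U by auto
      ultimately show "osum (E k) (\<lambda>x. Some (nabla m n (\<Xi> \<Delta>) (\<Delta> x))) ?V
          = Some (nabla m n (\<Xi> \<Delta>) (?F \<Delta> y))"
        using m.fdist_closed[OF \<Xi> \<Delta>']
        by (intro pcm_hom_osum[OF n.effect_algebra_axioms k.effect_algebra_axioms
              nabla_hom_right[OF k]])
    qed simp
    \<comment> \<open>Distinct distributions may have the same pushforward under \<open>f\<close>;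
      \<open>?\<Psi>\<close> adds up their weights, and integration along \<open>?F\<close> accounts
      for this.\<close>
    also have "\<dots> = osum (E k) (\<lambda>\<Gamma>. Some (nabla m n (?\<Psi> \<Gamma>) (\<Gamma> y))) (?F ` ?S)"
      using S \<Xi> F n.fdist_closed[OF _ y]
      by (intro osum_fdist_map[symmetric, where h = "\<lambda>a \<Gamma>. nabla m n a (\<Gamma> y)",
            OF m.effect_algebra_axioms k.effect_algebra_axioms nabla_hom_left[OF k]]) auto
    also have "\<dots> = Some (fdist_mult M E nabla m n Y ?\<Psi> y)"
      using \<Psi> S F y by (intro fdist_mult_value[OF k]) auto
    finally show "fdist_map (E k) X Y f ?g y = fdist_mult M E nabla m n Y ?\<Psi> y"
      by simp
  qed
qed

text \<open>Both sides are the sum of triple products over \<open>?S\<close> and \<open>?V\<close>.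
  Since \<open>?V\<close> collects the supports of all inner distributions, the two index sets are
  independent and the sums can be exchanged; \<open>nabla_assoc\<close> then acts termwise.\<close>

lemma fdist_mult_assoc:
  assumes mn: "padd M m n = Some mn" and k: "padd M mn p = Some k" and np: "padd M n p = Some np"
    and \<Theta>: "\<Theta> \<in> fdist (E m) (fdist (E n) (fdist (E p) X))"
  shows "fdist_mult M E nabla m np X
      (fdist_map (E m) (fdist (E n) (fdist (E p) X)) (fdist (E np) X) (fdist_mult M E nabla n p X) \<Theta>)
    = fdist_mult M E nabla mn p X (fdist_mult M E nabla m n (fdist (E p) X) \<Theta>)"
proof -
  have k': "padd M m np = Some k"
    using padd_assoc[of m n p] mn k np by simp
  interpret m: effect_algebra "E m" using effect_algebras[OF mn] by simp
  interpret n: effect_algebra "E n" using effect_algebras[OF mn] by simp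
  interpret p: effect_algebra "E p" using effect_algebras[OF k] by simp
  interpret mn: effect_algebra "E mn" using effect_algebras[OF k] by simp
  interpret np: effect_algebra "E np" using effect_algebras[OF np] by simp
  interpret k: effect_algebra "E k" using effect_algebras[OF k] by simp
  let ?R = "fdist (E p) X"
  let ?Q = "fdist (E n) ?R"
  let ?S = "supp (E m) ?Q \<Theta>" and ?V = "\<Union>\<Xi>\<in>supp (E m) ?Q \<Theta>. supp (E n) ?R \<Xi>"
  let ?\<mu> = "fdist_mult M E nabla n p X"
  let ?\<Psi> = "fdist_map (E m) ?Q (fdist (E np) X) ?\<mu> \<Theta>" and ?\<Gamma> = "fdist_mult M E nabla m n ?R \<Theta>"
  have S: "finite ?S" "?S \<subseteq> ?Q"
    using \<Theta> by (auto simp: fdist_def supp_def)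
  then have V: "finite ?V" "?V \<subseteq> ?R"
    by (auto simp: fdist_def supp_def)
  have \<mu>: "?\<mu> \<in> ?Q \<rightarrow> fdist (E np) X"
    using fdist_mult_closed(1)[OF np] by blast
  note \<Psi> = m.fdist_map_closed[OF \<Theta> \<mu>]
  note \<Gamma> = fdist_mult_closed[OF mn \<Theta>]
  show ?thesis
  proof (rule k.fdist_eqI[of _ X])
    show "fdist_mult M E nabla m np X ?\<Psi> \<in> fdist (E k) X"
      using \<Psi> by (intro fdist_mult_closed[OF k'])
    show "fdist_mult M E nabla mn p X ?\<Gamma> \<in> fdist (E k) X"
      using \<Gamma> by (intro fdist_mult_closed[OF k])
    fix x
    assume x: "x \<in> X"
    have \<Theta>c: "\<Theta> \<Xi> \<in> carrier (E m)" if "\<Xi> \<in> ?S" for \<Xi>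
      using that S m.fdist_closed[OF \<Theta>] by auto
    have \<Xi>c: "\<Xi> \<Delta> \<in> carrier (E n)" if "\<Xi> \<in> ?S" "\<Delta> \<in> ?V" for \<Xi> \<Delta>
      using that S(2) V(2) by (intro n.fdist_closed[of _ ?R]) auto
    have \<Delta>c: "\<Delta> x \<in> carrier (E p)" if "\<Delta> \<in> ?V" for \<Delta>
      using that V(2) by (intro p.fdist_closed[OF _ x]) auto
    let ?N = "\<lambda>\<Xi> \<Delta>. nabla m np (\<Theta> \<Xi>) (nabla n p (\<Xi> \<Delta>) (\<Delta> x))"
    have "Some (fdist_mult M E nabla m np X ?\<Psi> x)
        = osum (E k) (\<lambda>\<Lambda>. Some (nabla m np (?\<Psi> \<Lambda>) (\<Lambda> x))) (?\<mu> ` ?S)"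
      using \<Psi> S \<mu> x by (intro fdist_mult_value[OF k', symmetric]) auto
    \<comment> \<open>Integration along \<open>?\<mu>\<close> replaces the pushforward
      \<open>?\<Psi>\<close> by \<open>\<Theta>\<close> itself.\<close>
    also have "\<dots> = osum (E k) (\<lambda>\<Xi>. Some (nabla m np (\<Theta> \<Xi>) (?\<mu> \<Xi> x))) ?S"
      using S \<Theta> \<mu> np.fdist_closed[OF _ x]
      by (intro osum_fdist_map[where h = "\<lambda>a \<Lambda>. nabla m np a (\<Lambda> x)",
            OF m.effect_algebra_axioms k.effect_algebra_axioms nabla_hom_left[OF k']]) auto
    also have "\<dots> = osum (E k) (\<lambda>\<Xi>. osum (E k) (\<lambda>\<Delta>. Some (?N \<Xi> \<Delta>)) ?V) ?S"
    proof (rule k.osum.cong)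
      fix \<Xi>
      assume \<Xi>: "\<Xi> \<in> ?S"
      have "osum (E np) (\<lambda>\<Delta>. Some (nabla n p (\<Xi> \<Delta>) (\<Delta> x))) ?V = Some (?\<mu> \<Xi> x)"
        using \<Xi> S V x by (intro fdist_mult_value[OF np]) auto
      moreover have "(\<lambda>\<Delta>. nabla n p (\<Xi> \<Delta>) (\<Delta> x)) \<in> ?V \<rightarrow> carrier (E np)"
        using \<Xi>c[OF \<Xi>] \<Delta>c nabla_closed[OF np] by blast
      ultimately show "Some (nabla m np (\<Theta> \<Xi>) (?\<mu> \<Xi> x)) = osum (E k) (\<lambda>\<Delta>. Some (?N \<Xi> \<Delta>)) ?V"
        using \<Theta>c[OF \<Xi>]
        by (intro pcm_hom_osum[OF np.effect_algebra_axioms k.effect_algebra_axioms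
              nabla_hom_right[OF k'], symmetric])
    qed simp
    also have "\<dots> = osum (E k) (\<lambda>\<Delta>. osum (E k) (\<lambda>\<Xi>. Some (?N \<Xi> \<Delta>)) ?S) ?V"
      by (rule k.osum.swap)
    also have "\<dots> = osum (E k) (\<lambda>\<Delta>. Some (nabla mn p (?\<Gamma> \<Delta>) (\<Delta> x))) ?V"
    proof (rule k.osum.cong)
      fix \<Delta>
      assume \<Delta>: "\<Delta> \<in> ?V"
      have "osum (E k) (\<lambda>\<Xi>. Some (?N \<Xi> \<Delta>)) ?S
          = osum (E k) (\<lambda>\<Xi>. Some (nabla mn p (nabla m n (\<Theta> \<Xi>) (\<Xi> \<Delta>)) (\<Delta> x))) ?S"
        using \<Theta>c \<Xi>c[OF _ \<Delta>] \<Delta>c[OF \<Delta>] nabla_assoc[OF mn k np] by (intro k.osum.cong) auto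
      also have "\<dots> = Some (nabla mn p (?\<Gamma> \<Delta>) (\<Delta> x))"
      proof (rule pcm_hom_osum[OF mn.effect_algebra_axioms k.effect_algebra_axioms
              nabla_hom_left[OF k \<Delta>c[OF \<Delta>]]])
        show "(\<lambda>\<Xi>. nabla m n (\<Theta> \<Xi>) (\<Xi> \<Delta>)) \<in> ?S \<rightarrow> carrier (E mn)"
          using \<Theta>c \<Xi>c[OF _ \<Delta>] nabla_closed[OF mn] by blast
        show "osum (E mn) (\<lambda>\<Xi>. Some (nabla m n (\<Theta> \<Xi>) (\<Xi> \<Delta>))) ?S = Some (?\<Gamma> \<Delta>)"
          using S V \<Delta> by (intro fdist_mult_value[OF mn \<Theta>]) auto
      qed
      finally show "osum (E k) (\<lambda>\<Xi>. Some (?N \<Xi> \<Delta>)) ?S = Some (nabla mn p (?\<Gamma> \<Delta>) (\<Delta> x))" .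
    qed simp
    also have "\<dots> = Some (fdist_mult M E nabla mn p X ?\<Gamma> x)"
      using \<Gamma> V x by (intro fdist_mult_value[OF k])
    finally show "fdist_mult M E nabla m np X ?\<Psi> x = fdist_mult M E nabla mn p X ?\<Gamma> x"
      by simp
  qed
qed

section \<open>The unit and the unit laws\<close>

lemma effect_algebra_zero: "effect_algebra (E (zero M))"
  by (rule effect_algebra_E[OF zero_closed])

text \<open>The support is bounded by an inclusion: if zero and one coincide in
  \<open>E (zero M)\<close>, it is empty.\<close>

lemma fdist_unit_closed:
  assumes "x \<in> X"
  shows "fdist_unit M E X x \<in> fdist (E (zero M)) X"
    and "supp (E (zero M)) X (fdist_unit M E X x) \<subseteq> {x}"
proof -
  interpret Z: effect_algebra "E (zero M)" by (rule effect_algebra_zero)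
  show "fdist_unit M E X x \<in> fdist (E (zero M)) X"
    using assms Z.one_closed Z.zero_closed by (intro Z.fdistI[of _ _ "{x}"]) (auto simp: fdist_unit_def)
  show "supp (E (zero M)) X (fdist_unit M E X x) \<subseteq> {x}"
    using assms by (auto simp: supp_def fdist_unit_def)
qed

lemma fdist_unit_natural:
  assumes "x \<in> X" and "f \<in> X \<rightarrow> Y"
  shows "fdist_map (E (zero M)) X Y f (fdist_unit M E X x) = fdist_unit M E Y (f x)"
proof -
  interpret Z: effect_algebra "E (zero M)" by (rule effect_algebra_zero)
  note unit = fdist_unit_closed[OF assms(1)]
  show ?thesis
  proof (rule Z.fdist_eqI[of _ Y])
    show "fdist_map (E (zero M)) X Y f (fdist_unit M E X x) \<in> fdist (E (zero M)) Y"
      using unit assms by (intro Z.fdist_map_closed)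
    show "fdist_unit M E Y (f x) \<in> fdist (E (zero M)) Y"
      using assms by (intro fdist_unit_closed) auto
    fix y
    assume y: "y \<in> Y"
    have "osum (E (zero M)) (\<lambda>x'. Some (fdist_unit M E X x x')) {x' \<in> {x}. f x' = y}
        = Some (fdist_map (E (zero M)) X Y f (fdist_unit M E X x) y)"
      using unit assms y by (intro Z.fdist_map_value) auto
    moreover have "{x' \<in> {x}. f x' = y} = (if f x = y then {x} else {})"
      by auto
    ultimately show "fdist_map (E (zero M)) X Y f (fdist_unit M E X x) y = fdist_unit M E Y (f x) y"
      using assms y by (auto simp: fdist_unit_def split: if_splits)
  qed
qed

lemma fdist_mult_unit_right:
  assumes m: "m \<in> carrier M" and \<Delta>: "\<Delta> \<in> fdist (E m) X"
  shows "fdist_mult M E nabla m (zero M) X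
      (fdist_map (E m) X (fdist (E (zero M)) X) (fdist_unit M E X) \<Delta>) = \<Delta>"
proof -
  interpret Z: effect_algebra "E (zero M)" by (rule effect_algebra_zero)
  interpret m: effect_algebra "E m" by (rule effect_algebra_E[OF m])
  let ?\<Psi> = "fdist_map (E m) X (fdist (E (zero M)) X) (fdist_unit M E X) \<Delta>"
  have u: "fdist_unit M E X \<in> X \<rightarrow> fdist (E (zero M)) X"
    by (intro funcsetI fdist_unit_closed)
  note \<Psi> = m.fdist_map_closed[OF \<Delta> u]
  note k = padd_zero[OF m]
  show ?thesis
  proof (rule m.fdist_eqI[of _ X])
    show "fdist_mult M E nabla m (zero M) X ?\<Psi> \<in> fdist (E m) X"
      using \<Psi> by (intro fdist_mult_closed[OF k])
    fix x
    assume x: "x \<in> X"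
    \<comment> \<open>\<open>x\<close> is inserted so that the sum picks out
      \<open>\<Delta> x\<close> even where this weight is zero.\<close>
    let ?S = "insert x (supp (E m) X \<Delta>)"
    have S: "finite ?S" "?S \<subseteq> X"
      using \<Delta> x by (auto simp: fdist_def supp_def)
    have "Some (fdist_mult M E nabla m (zero M) X ?\<Psi> x)
        = osum (E m) (\<lambda>\<Gamma>. Some (nabla m (zero M) (?\<Psi> \<Gamma>) (\<Gamma> x))) (fdist_unit M E X ` ?S)"
      using \<Psi> S u x by (intro fdist_mult_value[OF k, symmetric]) auto
    also have "\<dots> = osum (E m) (\<lambda>x'. Some (nabla m (zero M) (\<Delta> x') (fdist_unit M E X x' x))) ?S"
      using S \<Delta> u Z.fdist_closed[OF _ x]
      by (intro osum_fdist_map[where h = "\<lambda>a \<Gamma>. nabla m (zero M) a (\<Gamma> x)",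
            OF m.effect_algebra_axioms m.effect_algebra_axioms nabla_hom_left[OF k]]) auto
    \<comment> \<open>The unit law of \<open>nabla\<close> keeps the term at \<open>x\<close>, and
      annihilation by zero removes all the others.\<close>
    also have "\<dots> = osum (E m) (\<lambda>x'. if x' = x then Some (\<Delta> x') else Some (zero (E m))) ?S"
    proof (rule m.osum.cong)
      fix x'
      assume "x' \<in> ?S"
      then have "x' \<in> X"
        using S by auto
      then show "Some (nabla m (zero M) (\<Delta> x') (fdist_unit M E X x' x))
          = (if x' = x then Some (\<Delta> x') else Some (zero (E m)))"
        using x m.fdist_closed[OF \<Delta>] nabla_unit_right[OF m] nabla_zero_right[OF k] eta_True
        by (auto simp: fdist_unit_def)
    qed simp
    also have "\<dots> = Some (\<Delta> x)"
      using S by (subst m.osum.delta) auto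
    finally show "fdist_mult M E nabla m (zero M) X ?\<Psi> x = \<Delta> x"
      by simp
  qed (rule \<Delta>)
qed

lemma fdist_mult_unit_left:
  assumes m: "m \<in> carrier M" and \<Delta>: "\<Delta> \<in> fdist (E m) X"
  shows "fdist_mult M E nabla (zero M) m X (fdist_unit M E (fdist (E m) X) \<Delta>) = \<Delta>"
proof -
  interpret m: effect_algebra "E m" by (rule effect_algebra_E[OF m])
  note k = padd_zero_left[OF m]
  note u = fdist_unit_closed[OF \<Delta>]
  show ?thesis
  proof (rule m.fdist_eqI[of _ X])
    show "fdist_mult M E nabla (zero M) m X (fdist_unit M E (fdist (E m) X) \<Delta>) \<in> fdist (E m) X"
      by (rule fdist_mult_closed[OF k u(1)])
    fix x
    assume x: "x \<in> X"
    \<comment> \<open>The unit distribution is concentrated at \<open>\<Delta>\<close>, so the sum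
      runs over \<open>{\<Delta>}\<close> and has one term.\<close>
    have "Some (fdist_mult M E nabla (zero M) m X (fdist_unit M E (fdist (E m) X) \<Delta>) x)
        = Some (nabla (zero M) m (fdist_unit M E (fdist (E m) X) \<Delta> \<Delta>) (\<Delta> x))"
      using fdist_mult_value[OF k u(1) _ u(2) _ x] \<Delta> by simp
    also have "\<dots> = Some (\<Delta> x)"
      using \<Delta> m.fdist_closed[OF \<Delta> x] nabla_unit_left[OF m] eta_True by (simp add: fdist_unit_def)
    finally show "fdist_mult M E nabla (zero M) m X (fdist_unit M E (fdist (E m) X) \<Delta>) x = \<Delta> x"
      by simp
  qed (rule \<Delta>)
qed

section \<open>The extension along the preorder of the grading\<close>

text \<open>In this locale \<open>M\<close> is a partial commutative monoid, where differences need
  not be unique. The lemmas on the extension therefore take the difference as a parameter together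
  with an equation for \<open>pdiff\<close>, which cancellation in the effect algebra
  \<open>M\<close> supplies at the end.\<close>

lemma fdist_ext_eq:
  assumes "pdiff M n m = d" and "\<Delta> \<in> fdist (E m) X"
  shows "fdist_ext M E nabla m n X \<Delta> = (\<lambda>x\<in>X. nabla m d (\<Delta> x) (one (E d)))"
  using assms by (simp add: fdist_ext_def)

lemma nabla_one_hom:
  assumes "padd M m d = Some n"
  shows "pcm_hom (E m) (E n) (\<lambda>a. nabla m d a (one (E d)))"
proof -
  interpret d: effect_algebra "E d" using effect_algebras[OF assms] by simp
  show ?thesis
    by (rule nabla_hom_left[OF assms d.one_closed])
qed

lemma fdist_ext_closed:
  assumes d: "padd M m d = Some n" and "pdiff M n m = d" and \<Delta>: "\<Delta> \<in> fdist (E m) X"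
  shows "fdist_ext M E nabla m n X \<Delta> \<in> fdist (E n) X"
  unfolding fdist_ext_eq[OF assms(2,3)]
  by (intro fdist_hom(1)[OF _ _ nabla_one_hom[OF d] \<Delta>] effect_algebras[OF d])

lemma fdist_ext_natural:
  assumes d: "padd M m d = Some n" and "pdiff M n m = d" and \<Delta>: "\<Delta> \<in> fdist (E m) X"
    and f: "f \<in> X \<rightarrow> Y"
  shows "fdist_map (E n) X Y f (fdist_ext M E nabla m n X \<Delta>)
       = fdist_ext M E nabla m n Y (fdist_map (E m) X Y f \<Delta>)"
proof -
  interpret m: effect_algebra "E m" using effect_algebras[OF d] by simp
  show ?thesis
    unfolding fdist_ext_eq[OF assms(2,3)] fdist_ext_eq[OF assms(2) m.fdist_map_closed(1)[OF \<Delta> f]]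
    by (intro fdist_map_hom[OF _ _ nabla_one_hom[OF d] \<Delta> f] effect_algebras[OF d])
qed

text \<open>The top element of \<open>E (zero M)\<close> is \<open>eta True\<close>, so this is the
  right unit law of \<open>nabla\<close>.\<close>

lemma fdist_ext_refl:
  assumes m: "m \<in> carrier M" and "pdiff M m m = zero M" and \<Delta>: "\<Delta> \<in> fdist (E m) X"
  shows "fdist_ext M E nabla m m X \<Delta> = \<Delta>"
proof -
  interpret m: effect_algebra "E m" by (rule effect_algebra_E[OF m])
  show ?thesis
  proof (rule m.fdist_eqI[of _ X])
    show "fdist_ext M E nabla m m X \<Delta> \<in> fdist (E m) X"
      by (rule fdist_ext_closed[OF padd_zero[OF m] assms(2,3)])
    fix x
    assume "x \<in> X"
    then show "fdist_ext M E nabla m m X \<Delta> x = \<Delta> x"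
      using nabla_unit_right[OF m m.fdist_closed[OF \<Delta>]] eta_True
      unfolding fdist_ext_eq[OF assms(2,3)] by simp
  qed (rule \<Delta>)
qed

text \<open>Successive extensions multiply by the top elements of \<open>E d\<close> and
  \<open>E e\<close>. Associativity of \<open>nabla\<close> brings these together, and a bimorphism
  sends the pair to the top element of \<open>E c\<close>.\<close>

lemma fdist_ext_trans:
  assumes d: "padd M m d = Some n" "pdiff M n m = d" and e: "padd M n e = Some p" "pdiff M p n = e"
    and c: "padd M d e = Some c" "pdiff M p m = c" and \<Delta>: "\<Delta> \<in> fdist (E m) X"
  shows "fdist_ext M E nabla n p X (fdist_ext M E nabla m n X \<Delta>) = fdist_ext M E nabla m p X \<Delta>"
proof -
  interpret m: effect_algebra "E m" using effect_algebras[OF d(1)] by simp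
  interpret d: effect_algebra "E d" using effect_algebras[OF d(1)] by simp
  interpret e: effect_algebra "E e" using effect_algebras[OF e(1)] by simp
  have "nabla d e (one (E d)) (one (E e)) = one (E c)"
    using nabla_bimorphism[OF c(1)] by (simp add: bimorphism_def)
  then show ?thesis
    unfolding fdist_ext_eq[OF e(2) fdist_ext_closed[OF d \<Delta>]] fdist_ext_eq[OF c(2) \<Delta>]
    unfolding fdist_ext_eq[OF d(2) \<Delta>]
    using nabla_assoc[OF d(1) e(1) c(1) m.fdist_closed[OF \<Delta>] d.one_closed e.one_closed]
    by (intro restrict_ext) simp
qed

section \<open>Structure maps as morphisms of sets, and assembly\<close>

lemma fdist_unit_PiE: "fdist_unit M E X \<in> X \<rightarrow>\<^sub>E fdist (E (zero M)) X"
proof (rule PiE_I)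
  show "fdist_unit M E X x = undefined" if "x \<notin> X" for x
    using that by (simp add: fdist_unit_def)
qed (rule fdist_unit_closed)

lemma fdist_mult_PiE:
  assumes "padd M m n = Some k"
  shows "fdist_mult M E nabla m n X \<in> fdist (E m) (fdist (E n) X) \<rightarrow>\<^sub>E fdist (E k) X"
  using fdist_mult_closed(1)[OF assms] by (auto intro!: PiE_I) (simp add: fdist_mult_def)

lemma fdist_ext_PiE:
  assumes "padd M m d = Some n" and "pdiff M n m = d"
  shows "fdist_ext M E nabla m n X \<in> fdist (E m) X \<rightarrow>\<^sub>E fdist (E n) X"
  using fdist_ext_closed[OF assms] by (auto intro!: PiE_I) (simp add: fdist_ext_def)

end

lemma compose_eqI:
  assumes "h \<in> extensional A" and "\<And>x. x \<in> A \<Longrightarrow> g (f x) = h x"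
  shows "compose A g f = h"
  using assms by (intro extensionalityI[of _ A]) (auto simp: compose_eq)

lemma nat_transI:
  assumes "\<And>X. \<alpha>_a X \<in> Sa X \<rightarrow>\<^sub>E Ta X" and "\<And>Y. \<alpha>_b Y \<in> Sb Y \<rightarrow>\<^sub>E Tb Y"
    and "\<And>X Y f t. f \<in> X \<rightarrow> Y \<Longrightarrow> t \<in> Sa X \<Longrightarrow> F X Y f (\<alpha>_a X t) = \<alpha>_b Y (G X Y f t)"
  shows "nat_trans Sa Sb G Ta Tb F \<alpha>_a \<alpha>_b"
  unfolding nat_trans_def compose_def
  using assms by (auto simp: PiE_def intro!: restrict_ext)

theorem mainTheorem8:
  fixes M :: "'m effect_struct"
    and E :: "'m \<Rightarrow> 'e effect_struct"
    and nabla :: "'m \<Rightarrow> 'm \<Rightarrow> 'e \<Rightarrow> 'e \<Rightarrow> 'e"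
    and eta :: "bool \<Rightarrow> 'e"
  assumes "effect_algebra M"
    and "graded_effect_monoid M E nabla eta"
  shows "extensible_graded_monad M
    (\<lambda>m. fdist (E m) :: 'a set \<Rightarrow> _)
    (\<lambda>m. fdist (E m) :: 'b set \<Rightarrow> _)
    (\<lambda>m. fdist (E m) :: 'c set \<Rightarrow> _)
    (\<lambda>m. fdist (E m)) (\<lambda>m. fdist (E m)) (\<lambda>m. fdist (E m))
    (\<lambda>m. fdist_map (E m)) (\<lambda>m. fdist_map (E m)) (\<lambda>m. fdist_map (E m)) (\<lambda>m. fdist_map (E m))
    (\<lambda>m. fdist_map (E m)) (\<lambda>m. fdist_map (E m)) (\<lambda>m. fdist_map (E m))
    (fdist_unit M E) (fdist_unit M E) (fdist_unit M E)
    (fdist_mult M E nabla) (fdist_mult M E nabla) (fdist_mult M E nabla)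
    (fdist_ext M E nabla) (fdist_ext M E nabla)"
proof -
  interpret M: effect_algebra M by fact
  interpret G: graded_effect_monoid M E nabla eta by fact
  show ?thesis
  proof unfold_locales
    fix m
    assume "m \<in> carrier M"
    then interpret m: effect_algebra "E m"
      by (rule G.effect_algebra_E)
    show "set_functor (fdist (E m) :: 'a set \<Rightarrow> _) (fdist (E m) :: 'b set \<Rightarrow> _)
        (fdist (E m) :: 'c set \<Rightarrow> _)
        (fdist_map (E m)) (fdist_map (E m)) (fdist_map (E m)) (fdist_map (E m))"
      by (rule m.set_functor_fdist)
  next
    show "nat_trans (\<lambda>X. X) (\<lambda>Y. Y) (\<lambda>X Y f. f)
        (fdist (E (zero M)) :: 'a set \<Rightarrow> _) (fdist (E (zero M)) :: 'b set \<Rightarrow> _)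
        (fdist_map (E (zero M))) (fdist_unit M E) (fdist_unit M E)"
      by (intro nat_transI G.fdist_unit_PiE G.fdist_unit_natural)
  next
    fix m n k
    assume k: "padd M m n = Some k"
    show "nat_trans (\<lambda>X :: 'a set. fdist (E m) (fdist (E n) X))
        (\<lambda>Y :: 'b set. fdist (E m) (fdist (E n) Y))
        (\<lambda>X Y f. fdist_map (E m) (fdist (E n) X) (fdist (E n) Y) (fdist_map (E n) X Y f))
        (fdist (E k)) (fdist (E k)) (fdist_map (E k))
        (fdist_mult M E nabla m n) (fdist_mult M E nabla m n)"
      by (intro nat_transI G.fdist_mult_PiE[OF k] G.fdist_mult_natural[OF k])
  next
    fix m n mn p k np and X :: "'a set"
    assume mn: "padd M m n = Some mn" and k: "padd M mn p = Some k" and np: "padd M n p = Some np"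
    show "compose (fdist (E m) (fdist (E n) (fdist (E p) X))) (fdist_mult M E nabla m np X)
          (fdist_map (E m) (fdist (E n) (fdist (E p) X)) (fdist (E np) X) (fdist_mult M E nabla n p X)) =
        compose (fdist (E m) (fdist (E n) (fdist (E p) X))) (fdist_mult M E nabla mn p X)
          (fdist_mult M E nabla m n (fdist (E p) X))"
      unfolding compose_def using G.fdist_mult_assoc[OF mn k np] by (intro restrict_ext)
  next
    fix m and X :: "'a set"
    assume m: "m \<in> carrier M"
    show "compose (fdist (E m) X) (fdist_mult M E nabla m (zero M) X)
        (fdist_map (E m) X (fdist (E (zero M)) X) (fdist_unit M E X)) = (\<lambda>t\<in>fdist (E m) X. t)"
      unfolding compose_def using G.fdist_mult_unit_right[OF m] by (intro restrict_ext)
  next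
    fix m and X :: "'a set"
    assume m: "m \<in> carrier M"
    show "compose (fdist (E m) X) (fdist_mult M E nabla (zero M) m X)
        (fdist_unit M E (fdist (E m) X)) = (\<lambda>t\<in>fdist (E m) X. t)"
      unfolding compose_def using G.fdist_mult_unit_left[OF m] by (intro restrict_ext)
  next
    fix m n
    assume "ple M m n"
    then obtain d where d: "padd M m d = Some n"
      by (auto simp: ple_def)
    \<comment> \<open>Cancellation in \<open>M\<close> identifies \<open>d\<close> with the
      difference occurring in \<open>fdist_ext\<close>.\<close>
    note d' = d M.pdiff_eq[OF d]
    show "nat_trans (fdist (E m) :: 'a set \<Rightarrow> _) (fdist (E m) :: 'b set \<Rightarrow> _) (fdist_map (E m))
        (fdist (E n)) (fdist (E n)) (fdist_map (E n)) (fdist_ext M E nabla m n) (fdist_ext M E nabla m n)"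
      by (intro nat_transI G.fdist_ext_PiE[OF d'] G.fdist_ext_natural[OF d'])
  next
    fix m and X :: "'a set"
    assume m: "m \<in> carrier M"
    note refl = G.fdist_ext_refl[OF m M.pdiff_eq[OF M.padd_zero[OF m]]]
    show "fdist_ext M E nabla m m X = (\<lambda>t\<in>fdist (E m) X. t)"
      using refl by (intro extensionalityI[of _ "fdist (E m) X"]) (simp add: fdist_ext_def, simp, simp)
  next
    fix m n p and X :: "'a set"
    assume "ple M m n" and "ple M n p"
    then obtain d e where d: "padd M m d = Some n" and e: "padd M n e = Some p"
      by (auto simp: ple_def)
    \<comment> \<open>Regrouping \<open>p = (m + d) + e\<close> shows that \<open>d + e\<close> is
      defined and is the difference of \<open>p\<close> and \<open>m\<close>.\<close>
    then have "Option.bind (padd M d e) (padd M m) = Some p"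
      using M.padd_assoc[of m d e] by simp
    then obtain c where c: "padd M d e = Some c" and c': "padd M m c = Some p"
      by (auto simp: bind_eq_Some_conv)
    have "fdist_ext M E nabla m p X \<in> extensional (fdist (E m) X)"
      by (simp add: fdist_ext_def)
    then show "compose (fdist (E m) X) (fdist_ext M E nabla n p X) (fdist_ext M E nabla m n X)
        = fdist_ext M E nabla m p X"
      by (rule compose_eqI)
        (rule G.fdist_ext_trans[OF d M.pdiff_eq[OF d] e M.pdiff_eq[OF e] c M.pdiff_eq[OF c']])
  qed
qed

end
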